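(* Let $(M,L)$ be a Finsler manifold of scalar curvature $\kappa$. If $\kappa$ vanishes, then the gradient $\mathrm{grad}\,f$ of any smooth function $f$ on $\mathcal{T}M$ is $\overline{d}$-closed (equivalently, all gradient $\pi$-vector fields are $\overline{d}$-closed).
   Context: All objects are $C^\infty$. $M$ is an $n$-dimensional manifold, $\mathcal{T}M$ is the bundle of nonzero tangent vectors, $\pi:\mathcal{T}M\to M$ the projection, and $\pi^{-1}(TM)\to\mathcal{T}M$ the pullback of $TM$ by $\pi$. Its sections are called $\pi$-vector fields; tensor fields (forms) on $\pi^{-1}(TM)$ are called $\pi$-tensor fields ($\pi$-forms). A Finsler structure $L$ on $M$ is positive and smooth on $\mathcal{T}M$, positively homogeneous of degree 1 on fibres, and the fibrewise Hessian $g$ of $\frac12L^2$, a metric on $\pi^{-1}(TM)$ called the Finsler metric, is positive definite. The fundamental $\pi$-vector field is $\overline{\eta}(u)=(u,u)$. Let $\rho:T(\mathcal{T}M)\to\pi^{-1}(TM)$, $\rho(X)=(u,d\pi(X))$ for $X\in T_u(\mathcal{T}M)$, and $\gamma:\pi^{-1}(TM)\to T(\mathcal{T}M)$, $\gamma(u,v)=\frac{d}{dt}\big|_{t=0}(u+tv)$. For a linear connection $\nabla$ in $\pi^{-1}(TM)$, its connection map is $K(X)=\nabla_X\overline{\eta}$; $\nabla$ is regular if $T(\mathcal{T}M)=V(\mathcal{T}M)\oplus H(\mathcal{T}M)$, where $V(\mathcal TM)=\ker\rho$ and $H(\mathcal TM)=\ker K$. For regular $\nabla$ set $\beta=(\rho|_{H(\mathcal{T}M)})^{-1}$.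 The torsion is $\mathbf{T}(X,Y)=\nabla_X\rho Y-\nabla_Y\rho X-\rho[X,Y]$, with $Q(\overline{X},\overline{Y})=\mathbf{T}(\beta\overline{X},\beta\overline{Y})$ and $T(\overline{X},\overline{Y})=\mathbf{T}(\gamma\overline{X},\beta\overline{Y})$. The Cartan connection of $(M,L)$ is the unique regular connection $\nabla$ in $\pi^{-1}(TM)$ with $\nabla g=0$, $Q=0$ and $g(T(\overline{X},\overline{Y}),\overline{Z})=g(T(\overline{X},\overline{Z}),\overline{Y})$. Everything below refers to it. Its curvature is $\mathbf{K}(X,Y)\overline{Z}=-\nabla_X\nabla_Y\overline{Z}+\nabla_Y\nabla_X\overline{Z}+\nabla_{[X,Y]}\overline{Z}$; put $R(\overline{X},\overline{Y})\overline{Z}=\mathbf{K}(\beta\overline{X},\beta\overline{Y})\overline{Z}$ and $\widehat{R}(\overline{X},\overline{Y})=R(\overline{X},\overline{Y})\overline{\eta}$. $(M,L)$ is of scalar curvature $\kappa$ ($\kappa$ a function on $\mathcal{T}M$, called the horizontal scalar curvature) if $\widehat{R}=\omega\wedge\phi$, i.e. $\widehat{R}(\overline{X},\overline{Y})=\omega(\overline{X})\phi(\overline{Y})-\omega(\overline{Y})\phi(\overline{X})$, where $\ell=L^{-1}i_{\overline{\eta}}g=dL\circ\gamma$, $\phi=I-L^{-1}\ell\otimes\overline{\eta}$ (so $\phi(\overline{X})=\overline{X}-L^{-1}\ell(\overline{X})\overline{\eta}$), and $\omega=\frac13L\,(L\,\overline{d}_J\kappa+3\kappa\,\ell)$ with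 $\overline{d}_J\kappa=d\kappa\circ\gamma$. For a function $f$ on $\mathcal{T}M$, $(\overline{d}f)(\overline{X})=\beta\overline{X}\cdot f$; for a 1-$\pi$-form $\theta$, $(\overline{d}\theta)(\overline{X},\overline{Y})=\beta\overline{X}\cdot\theta(\overline{Y})-\beta\overline{Y}\cdot\theta(\overline{X})-\theta(\rho[\beta\overline{X},\beta\overline{Y}])$. A $\pi$-vector field $\overline{X}$ is $\overline{d}$-closed if $\overline{d}(i_{\overline{X}}g)=0$, where $i_{\overline{X}}g=g(\overline{X},\cdot)$. The gradient of $f$ is the $\pi$-vector field $\overline{X}=\mathrm{grad}\,f$ with $i_{\overline{X}}g=\overline{d}f$; a gradient $\pi$-vector field is one of this form. *)

theory Defs
  imports "HOL-Analysis.Analysis" "HOL-Library.Function_Algebras"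
begin

section \<open>Smooth manifolds\<close>

primrec Ck_on :: "nat \<Rightarrow> 'e::real_normed_vector set \<Rightarrow> ('e \<Rightarrow> 'f::real_normed_vector) \<Rightarrow> bool" where
  "Ck_on 0 S f \<longleftrightarrow> continuous_on S f"
| "Ck_on (Suc k) S f \<longleftrightarrow> (\<forall>x\<in>S. f differentiable (at x)) \<and>
     (\<forall>w. Ck_on k S (\<lambda>x. frechet_derivative f (at x) w))"

text \<open>Only used for open \<open>S\<close> in a finite-dimensional space, where it is the usual notion.\<close>

definition smooth_on :: "'e::real_normed_vector set \<Rightarrow> ('e \<Rightarrow> 'f::real_normed_vector) \<Rightarrow> bool" where
  "smooth_on S f \<longleftrightarrow> (\<forall>k. Ck_on k S f)"

text \<open>A chart is a pair \<open>(U, c)\<close>; only the values of \<open>c\<close> on \<open>U\<close> matter. The manifold is the whole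
  type \<open>'a\<close>, of dimension \<open>DIM('e)\<close>. The Hausdorff and second countability axioms are imposed on
  \<open>'a\<close> through type classes where a theorem is stated.\<close>

type_synonym ('a, 'e) chart = "'a set \<times> ('a \<Rightarrow> 'e)"

definition smooth_atlas :: "('a::topological_space, 'e::euclidean_space) chart set \<Rightarrow> bool" where
  "smooth_atlas A \<longleftrightarrow>
     (\<Union>(U, c)\<in>A. U) = UNIV \<and>
     (\<forall>(U, c)\<in>A. open U \<and> open (c ` U) \<and> homeomorphism U (c ` U) c (inv_into U c)) \<and>
     (\<forall>(U, c)\<in>A. \<forall>(V, d)\<in>A. smooth_on (c ` (U \<inter> V)) (d \<circ> inv_into U c))"

definition smooth_funs :: "('p, 'e::euclidean_space) chart set \<Rightarrow> ('p \<Rightarrow> real) set" where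
  "smooth_funs A = {f. \<forall>(U, c)\<in>A. smooth_on (c ` U) (f \<circ> inv_into U c)}"

text \<open>Tangent vectors at \<open>p\<close> are the derivations at \<open>p\<close> of the algebra of smooth functions; they
  are extended by 0 to the non-smooth functions, so that distinct derivations are distinct HOL
  functions and linear combinations can be formed pointwise. The operations \<open>+\<close>, \<open>-\<close>, \<open>0\<close> on tangent
  vectors and \<open>*\<close> on scalar functions are those of \<open>Function_Algebras\<close>.

  The same definition serves for a manifold that is only a subset of \<open>'p\<close>, the union of its chart
  domains (below: the slit tangent bundle): smooth functions then have arbitrary values off the
  manifold, but the Leibniz rule forces \<open>D f\<close> to depend on the values of \<open>f\<close> on the manifold only.\<close>

type_synonym 'p tvec = "('p \<Rightarrow> real) \<Rightarrow> real"

abbreviation vscale :: "real \<Rightarrow> 'p tvec \<Rightarrow> 'p tvec"  (infixr "*\<^sub>v" 75) where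
  "a *\<^sub>v D \<equiv> (\<lambda>f. a * D f)"

definition tangent_space :: "('p, 'e::euclidean_space) chart set \<Rightarrow> 'p \<Rightarrow> 'p tvec set" where
  "tangent_space A p = {D.
     (\<forall>f. f \<notin> smooth_funs A \<longrightarrow> D f = 0) \<and>
     (\<forall>f\<in>smooth_funs A. \<forall>g\<in>smooth_funs A. D (f + g) = D f + D g) \<and>
     (\<forall>f\<in>smooth_funs A. \<forall>a. D (\<lambda>x. a * f x) = a * D f) \<and>
     (\<forall>f\<in>smooth_funs A. \<forall>g\<in>smooth_funs A. D (f * g) = D f * g p + f p * D g)}"

definition vector_fields :: "('p, 'e::euclidean_space) chart set \<Rightarrow> 'p set \<Rightarrow> ('p \<Rightarrow> 'p tvec) set" where
  "vector_fields A N = {X. (\<forall>p\<in>N. X p \<in> tangent_space A p) \<and>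
     (\<forall>f\<in>smooth_funs A. (\<lambda>p. X p f) \<in> smooth_funs A)}"

definition lie_bracket ::
  "('p, 'e::euclidean_space) chart set \<Rightarrow> ('p \<Rightarrow> 'p tvec) \<Rightarrow> ('p \<Rightarrow> 'p tvec) \<Rightarrow> 'p \<Rightarrow> 'p tvec" where
  "lie_bracket A X Y p =
     (\<lambda>f. if f \<in> smooth_funs A then X p (\<lambda>q. Y q f) - Y p (\<lambda>q. X q f) else 0)"


section \<open>The slit tangent bundle\<close>

text \<open>An element of \<open>TM\<close> is a pair \<open>(p, v)\<close> with \<open>v \<in> T\<^sub>pM\<close>.\<close>

type_synonym 'a tb = "'a \<times> 'a tvec"

definition slit_bundle :: "('a, 'e::euclidean_space) chart set \<Rightarrow> 'a tb set" where
  "slit_bundle A = {(p, v). v \<in> tangent_space A p \<and> v \<noteq> 0}"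

text \<open>The tangent vector \<open>\<Sum>i. w\<^sub>i (\<partial>/\<partial>x\<^sub>i)\<close> at \<open>p\<close> in the chart \<open>(U, c)\<close>.\<close>

definition chart_vector ::
  "('a, 'e::euclidean_space) chart set \<Rightarrow> ('a, 'e) chart \<Rightarrow> 'a \<Rightarrow> 'e \<Rightarrow> 'a tvec" where
  "chart_vector A = (\<lambda>(U, c) p w h.
     if h \<in> smooth_funs A then frechet_derivative (h \<circ> inv_into U c) (at (c p)) w else 0)"

text \<open>The standard charts of the slit tangent bundle, \<open>(p, v) \<mapsto> (c p, components of v)\<close>.\<close>

definition slit_chart ::
  "('a, 'e::euclidean_space) chart set \<Rightarrow> ('a, 'e) chart \<Rightarrow> ('a tb, 'e \<times> 'e) chart" where
  "slit_chart A C =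
     ({u \<in> slit_bundle A. fst u \<in> fst C},
      \<lambda>u. (snd C (fst u), THE w. snd u = chart_vector A C (fst u) w))"

definition slit_atlas ::
  "('a, 'e::euclidean_space) chart set \<Rightarrow> ('a tb, 'e \<times> 'e) chart set" where
  "slit_atlas A = slit_chart A ` A"

text \<open>A \<open>\<pi>\<close>-vector field sends \<open>u\<close> to an element \<open>(u, Z u)\<close> of the pullback bundle; it is represented
  by its second component \<open>u \<mapsto> Z u \<in> T\<^bsub>\<pi> u\<^esub>M\<close>. In the same way the fibre of the pullback bundle over
  \<open>u\<close> is identified with the tangent space of \<open>M\<close> at \<open>fst u\<close>, and the fundamental \<open>\<pi>\<close>-vector field is
  \<open>snd\<close>.\<close>

definition pi_fields :: "('a, 'e::euclidean_space) chart set \<Rightarrow> ('a tb \<Rightarrow> 'a tvec) set" where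
  "pi_fields A = {Z. (\<forall>u\<in>slit_bundle A. Z u \<in> tangent_space A (fst u)) \<and>
     (\<forall>h\<in>smooth_funs A. (\<lambda>u. Z u h) \<in> smooth_funs (slit_atlas A))}"

abbreviation eta :: "'a tb \<Rightarrow> 'a tvec" where
  "eta \<equiv> snd"

definition rho :: "('a, 'e::euclidean_space) chart set \<Rightarrow> 'a tb tvec \<Rightarrow> 'a tvec" where
  "rho A X = (\<lambda>h. if h \<in> smooth_funs A then X (h \<circ> fst) else 0)"

definition gam :: "('a, 'e::euclidean_space) chart set \<Rightarrow> 'a tb \<Rightarrow> 'a tvec \<Rightarrow> 'a tb tvec" where
  "gam A u v = (\<lambda>f. if f \<in> smooth_funs (slit_atlas A)
     then deriv (\<lambda>t. f (fst u, snd u + t *\<^sub>v v)) 0 else 0)"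


section \<open>Finsler structures\<close>

definition finsler_metric :: "('a tb \<Rightarrow> real) \<Rightarrow> 'a tb \<Rightarrow> 'a tvec \<Rightarrow> 'a tvec \<Rightarrow> real" where
  "finsler_metric L u v w =
     deriv (\<lambda>s. deriv (\<lambda>t. 1/2 * (L (fst u, snd u + s *\<^sub>v v + t *\<^sub>v w))\<^sup>2) 0) 0"

definition finsler_structure ::
  "('a, 'e::euclidean_space) chart set \<Rightarrow> ('a tb \<Rightarrow> real) \<Rightarrow> bool" where
  "finsler_structure A L \<longleftrightarrow>
     L \<in> smooth_funs (slit_atlas A) \<and>
     (\<forall>u\<in>slit_bundle A. L u > 0) \<and>
     (\<forall>u\<in>slit_bundle A. \<forall>a>0. L (fst u, a *\<^sub>v snd u) = a * L u) \<and>
     (\<forall>u\<in>slit_bundle A. \<forall>v\<in>tangent_space A (fst u). v \<noteq> 0 \<longrightarrow> finsler_metric L u v v > 0)"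


section \<open>Connections in the pullback bundle\<close>

text \<open>\<open>nabla u X Z\<close> is the covariant derivative of the \<open>\<pi>\<close>-vector field \<open>Z\<close> in the direction of the
  tangent vector \<open>X\<close> of the slit tangent bundle at \<open>u\<close>.\<close>

type_synonym 'a pi_connection = "'a tb \<Rightarrow> 'a tb tvec \<Rightarrow> ('a tb \<Rightarrow> 'a tvec) \<Rightarrow> 'a tvec"

definition linear_connection ::
  "('a, 'e::euclidean_space) chart set \<Rightarrow> 'a pi_connection \<Rightarrow> bool" where
  "linear_connection A nabla \<longleftrightarrow>
     (\<forall>u\<in>slit_bundle A. \<forall>X\<in>tangent_space (slit_atlas A) u. \<forall>Z\<in>pi_fields A.
        nabla u X Z \<in> tangent_space A (fst u)) \<and>
     (\<forall>u\<in>slit_bundle A. \<forall>X\<in>tangent_space (slit_atlas A) u. \<forall>Y\<in>tangent_space (slit_atlas A) u.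
        \<forall>Z\<in>pi_fields A. nabla u (X + Y) Z = nabla u X Z + nabla u Y Z) \<and>
     (\<forall>u\<in>slit_bundle A. \<forall>X\<in>tangent_space (slit_atlas A) u. \<forall>Z\<in>pi_fields A. \<forall>a.
        nabla u (a *\<^sub>v X) Z = a *\<^sub>v nabla u X Z) \<and>
     (\<forall>u\<in>slit_bundle A. \<forall>X\<in>tangent_space (slit_atlas A) u. \<forall>Z\<in>pi_fields A. \<forall>W\<in>pi_fields A.
        nabla u X (\<lambda>v. Z v + W v) = nabla u X Z + nabla u X W) \<and>
     (\<forall>u\<in>slit_bundle A. \<forall>X\<in>tangent_space (slit_atlas A) u. \<forall>Z\<in>pi_fields A.
        \<forall>f\<in>smooth_funs (slit_atlas A).
        nabla u X (\<lambda>v. f v *\<^sub>v Z v) = X f *\<^sub>v Z u + f u *\<^sub>v nabla u X Z) \<and>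
     (\<forall>X\<in>vector_fields (slit_atlas A) (slit_bundle A). \<forall>Z\<in>pi_fields A.
        (\<lambda>u. nabla u (X u) Z) \<in> pi_fields A)"

definition connection_map :: "'a pi_connection \<Rightarrow> 'a tb \<Rightarrow> 'a tb tvec \<Rightarrow> 'a tvec" where
  "connection_map nabla u X = nabla u X eta"

definition vert :: "('a, 'e::euclidean_space) chart set \<Rightarrow> 'a tb \<Rightarrow> 'a tb tvec set" where
  "vert A u = {X \<in> tangent_space (slit_atlas A) u. rho A X = 0}"

definition hor ::
  "('a, 'e::euclidean_space) chart set \<Rightarrow> 'a pi_connection \<Rightarrow> 'a tb \<Rightarrow> 'a tb tvec set" where
  "hor A nabla u = {X \<in> tangent_space (slit_atlas A) u. connection_map nabla u X = 0}"

definition regular_connection ::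
  "('a, 'e::euclidean_space) chart set \<Rightarrow> 'a pi_connection \<Rightarrow> bool" where
  "regular_connection A nabla \<longleftrightarrow> linear_connection A nabla \<and>
     (\<forall>u\<in>slit_bundle A.
        tangent_space (slit_atlas A) u = {X + Y | X Y. X \<in> vert A u \<and> Y \<in> hor A nabla u} \<and>
        vert A u \<inter> hor A nabla u = {0})"

definition beta ::
  "('a, 'e::euclidean_space) chart set \<Rightarrow> 'a pi_connection \<Rightarrow> 'a tb \<Rightarrow> 'a tvec \<Rightarrow> 'a tb tvec" where
  "beta A nabla u = the_inv_into (hor A nabla u) (rho A)"

text \<open>\<open>\<gamma>X\<close> and \<open>\<beta>X\<close> for a \<open>\<pi>\<close>-vector field \<open>X\<close>.\<close>

definition vlift ::
  "('a, 'e::euclidean_space) chart set \<Rightarrow> ('a tb \<Rightarrow> 'a tvec) \<Rightarrow> 'a tb \<Rightarrow> 'a tb tvec" where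
  "vlift A X = (\<lambda>u. gam A u (X u))"

definition hlift ::
  "('a, 'e::euclidean_space) chart set \<Rightarrow> 'a pi_connection \<Rightarrow> ('a tb \<Rightarrow> 'a tvec) \<Rightarrow> 'a tb \<Rightarrow> 'a tb tvec"
  where
  "hlift A nabla X = (\<lambda>u. beta A nabla u (X u))"

definition torsion ::
  "('a, 'e::euclidean_space) chart set \<Rightarrow> 'a pi_connection \<Rightarrow>
   ('a tb \<Rightarrow> 'a tb tvec) \<Rightarrow> ('a tb \<Rightarrow> 'a tb tvec) \<Rightarrow> 'a tb \<Rightarrow> 'a tvec" where
  "torsion A nabla X Y u =
     nabla u (X u) (\<lambda>v. rho A (Y v)) - nabla u (Y u) (\<lambda>v. rho A (X v))
       - rho A (lie_bracket (slit_atlas A) X Y u)"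

definition torsion_Q ::
  "('a, 'e::euclidean_space) chart set \<Rightarrow> 'a pi_connection \<Rightarrow>
   ('a tb \<Rightarrow> 'a tvec) \<Rightarrow> ('a tb \<Rightarrow> 'a tvec) \<Rightarrow> 'a tb \<Rightarrow> 'a tvec" where
  "torsion_Q A nabla X Y = torsion A nabla (hlift A nabla X) (hlift A nabla Y)"

definition torsion_T ::
  "('a, 'e::euclidean_space) chart set \<Rightarrow> 'a pi_connection \<Rightarrow>
   ('a tb \<Rightarrow> 'a tvec) \<Rightarrow> ('a tb \<Rightarrow> 'a tvec) \<Rightarrow> 'a tb \<Rightarrow> 'a tvec" where
  "torsion_T A nabla X Y = torsion A nabla (vlift A X) (hlift A nabla Y)"

definition metric_connection ::
  "('a, 'e::euclidean_space) chart set \<Rightarrow> ('a tb \<Rightarrow> real) \<Rightarrow> 'a pi_connection \<Rightarrow> bool" where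
  "metric_connection A L nabla \<longleftrightarrow>
     (\<forall>u\<in>slit_bundle A. \<forall>X\<in>tangent_space (slit_atlas A) u. \<forall>Y\<in>pi_fields A. \<forall>Z\<in>pi_fields A.
        X (\<lambda>v. finsler_metric L v (Y v) (Z v)) =
          finsler_metric L u (nabla u X Y) (Z u) + finsler_metric L u (Y u) (nabla u X Z))"

definition cartan_connection ::
  "('a, 'e::euclidean_space) chart set \<Rightarrow> ('a tb \<Rightarrow> real) \<Rightarrow> 'a pi_connection \<Rightarrow> bool" where
  "cartan_connection A L nabla \<longleftrightarrow>
     regular_connection A nabla \<and> metric_connection A L nabla \<and>
     (\<forall>X\<in>pi_fields A. \<forall>Y\<in>pi_fields A. \<forall>u\<in>slit_bundle A. torsion_Q A nabla X Y u = 0) \<and>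
     (\<forall>X\<in>pi_fields A. \<forall>Y\<in>pi_fields A. \<forall>Z\<in>pi_fields A. \<forall>u\<in>slit_bundle A.
        finsler_metric L u (torsion_T A nabla X Y u) (Z u) =
          finsler_metric L u (torsion_T A nabla X Z u) (Y u))"


section \<open>Curvature\<close>

definition curvature ::
  "('a, 'e::euclidean_space) chart set \<Rightarrow> 'a pi_connection \<Rightarrow> ('a tb \<Rightarrow> 'a tb tvec) \<Rightarrow>
   ('a tb \<Rightarrow> 'a tb tvec) \<Rightarrow> ('a tb \<Rightarrow> 'a tvec) \<Rightarrow> 'a tb \<Rightarrow> 'a tvec" where
  "curvature A nabla X Y Z u =
     - nabla u (X u) (\<lambda>v. nabla v (Y v) Z) + nabla u (Y u) (\<lambda>v. nabla v (X v) Z)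
       + nabla u (lie_bracket (slit_atlas A) X Y u) Z"

definition h_curvature ::
  "('a, 'e::euclidean_space) chart set \<Rightarrow> 'a pi_connection \<Rightarrow> ('a tb \<Rightarrow> 'a tvec) \<Rightarrow>
   ('a tb \<Rightarrow> 'a tvec) \<Rightarrow> ('a tb \<Rightarrow> 'a tvec) \<Rightarrow> 'a tb \<Rightarrow> 'a tvec" where
  "h_curvature A nabla X Y Z = curvature A nabla (hlift A nabla X) (hlift A nabla Y) Z"

definition R_hat ::
  "('a, 'e::euclidean_space) chart set \<Rightarrow> 'a pi_connection \<Rightarrow>
   ('a tb \<Rightarrow> 'a tvec) \<Rightarrow> ('a tb \<Rightarrow> 'a tvec) \<Rightarrow> 'a tb \<Rightarrow> 'a tvec" where
  "R_hat A nabla X Y = h_curvature A nabla X Y eta"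

definition ell :: "('a tb \<Rightarrow> real) \<Rightarrow> 'a tb \<Rightarrow> 'a tvec \<Rightarrow> real" where
  "ell L u v = inverse (L u) * finsler_metric L u (eta u) v"

definition phi :: "('a tb \<Rightarrow> real) \<Rightarrow> 'a tb \<Rightarrow> 'a tvec \<Rightarrow> 'a tvec" where
  "phi L u v = v - (inverse (L u) * ell L u v) *\<^sub>v eta u"

definition dJ :: "('a, 'e::euclidean_space) chart set \<Rightarrow> ('a tb \<Rightarrow> real) \<Rightarrow> 'a tb \<Rightarrow> 'a tvec \<Rightarrow> real" where
  "dJ A f u v = gam A u v f"

definition omega ::
  "('a, 'e::euclidean_space) chart set \<Rightarrow> ('a tb \<Rightarrow> real) \<Rightarrow> ('a tb \<Rightarrow> real) \<Rightarrow> 'a tb \<Rightarrow> 'a tvec \<Rightarrow> real"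
  where
  "omega A L \<kappa> u v = 1/3 * L u * (L u * dJ A \<kappa> u v + 3 * \<kappa> u * ell L u v)"

definition scalar_curvature ::
  "('a, 'e::euclidean_space) chart set \<Rightarrow> ('a tb \<Rightarrow> real) \<Rightarrow> 'a pi_connection \<Rightarrow> ('a tb \<Rightarrow> real) \<Rightarrow> bool"
  where
  "scalar_curvature A L nabla \<kappa> \<longleftrightarrow> \<kappa> \<in> smooth_funs (slit_atlas A) \<and>
     (\<forall>X\<in>pi_fields A. \<forall>Y\<in>pi_fields A. \<forall>u\<in>slit_bundle A.
        R_hat A nabla X Y u =
          omega A L \<kappa> u (X u) *\<^sub>v phi L u (Y u) - omega A L \<kappa> u (Y u) *\<^sub>v phi L u (X u))"


section \<open>The horizontal differential and gradients\<close>

definition dbar_fun ::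
  "('a, 'e::euclidean_space) chart set \<Rightarrow> 'a pi_connection \<Rightarrow> ('a tb \<Rightarrow> real) \<Rightarrow> 'a tb \<Rightarrow> 'a tvec \<Rightarrow> real"
  where
  "dbar_fun A nabla f u v = beta A nabla u v f"

definition dbar_form ::
  "('a, 'e::euclidean_space) chart set \<Rightarrow> 'a pi_connection \<Rightarrow> ('a tb \<Rightarrow> 'a tvec \<Rightarrow> real) \<Rightarrow>
   ('a tb \<Rightarrow> 'a tvec) \<Rightarrow> ('a tb \<Rightarrow> 'a tvec) \<Rightarrow> 'a tb \<Rightarrow> real" where
  "dbar_form A nabla \<theta> X Y u =
     hlift A nabla X u (\<lambda>v. \<theta> v (Y v)) - hlift A nabla Y u (\<lambda>v. \<theta> v (X v))
       - \<theta> u (rho A (lie_bracket (slit_atlas A) (hlift A nabla X) (hlift A nabla Y) u))"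

definition metric_dual :: "('a tb \<Rightarrow> real) \<Rightarrow> ('a tb \<Rightarrow> 'a tvec) \<Rightarrow> 'a tb \<Rightarrow> 'a tvec \<Rightarrow> real" where
  "metric_dual L X u v = finsler_metric L u (X u) v"

definition dbar_closed ::
  "('a, 'e::euclidean_space) chart set \<Rightarrow> ('a tb \<Rightarrow> real) \<Rightarrow> 'a pi_connection \<Rightarrow>
   ('a tb \<Rightarrow> 'a tvec) \<Rightarrow> bool" where
  "dbar_closed A L nabla W \<longleftrightarrow>
     (\<forall>X\<in>pi_fields A. \<forall>Y\<in>pi_fields A. \<forall>u\<in>slit_bundle A.
        dbar_form A nabla (metric_dual L W) X Y u = 0)"

text \<open>The gradient is determined fibre by fibre, since the metric is nondegenerate on each fibre.\<close>

definition grad ::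
  "('a, 'e::euclidean_space) chart set \<Rightarrow> ('a tb \<Rightarrow> real) \<Rightarrow> 'a pi_connection \<Rightarrow> ('a tb \<Rightarrow> real) \<Rightarrow>
   'a tb \<Rightarrow> 'a tvec" where
  "grad A L nabla f u = (THE v. v \<in> tangent_space A (fst u) \<and>
     (\<forall>w\<in>tangent_space A (fst u). finsler_metric L u v w = dbar_fun A nabla f u w))"

end

theory Submission
  imports Defs
begin

text \<open>Since \<open>K \<circ> \<beta> = 0\<close>, both covariant derivatives in the curvature \<open>R_hat\<close> vanish, which leaves
  the vertical component \<open>K [\<beta>X, \<beta>Y]\<close> of the bracket of the horizontal lifts. It vanishes when
  \<open>\<kappa> = 0\<close>, hence the bracket is horizontal and equals \<open>\<beta> (\<rho> [\<beta>X, \<beta>Y])\<close>. Since the metric dual of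
  \<open>grad f\<close> is \<open>df \<circ> \<beta>\<close>, its horizontal differential at \<open>(X, Y)\<close> is
  \<open>\<beta>X (\<beta>Y f) - \<beta>Y (\<beta>X f) - \<beta> (\<rho> [\<beta>X, \<beta>Y]) f = 0\<close>. The analytic work lies in the finite dimension
  of the spaces of derivations, which gives the existence of \<open>grad f\<close>, and in the smoothness of the
  horizontal lifts, which makes their bracket a tangent vector.\<close>

section \<open>Calculus of smooth functions\<close>

text \<open>The curvature obstructs the identity that the horizontal differential squares to zero:
  the bracket of two horizontal lifts may leave the horizontal distribution. Two features of the
  encoding shape what surrounds this short computation. Tangent vectors are derivations acting on
  total HOL functions, so an identity that holds only on \<open>slit_bundle A\<close> cannot be
  substituted under a tangent vector or under \<open>nabla\<close> as an equality of functions. The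
  indicator function of the complement of the manifold is smooth, and the Leibniz rule applied with
  this factor removes the difference each time. Moreover, the charts of the slit bundle are
  injective with open images, but no topology is set up on the bundle itself. The local theory of
  derivations is therefore developed in the locale \<open>charted\<close>, whose only inputs are
  such charts and cutoff functions, and is interpreted both for the manifold and for the slit
  bundle. Since \<open>linear_connection\<close> grants smoothness only along globally defined
  vector fields, local frames are cut off and extended before the connection is applied to
  them.\<close>

lemma Ck_on_cong_imp:
  assumes "open S" "\<And>x. x \<in> S \<Longrightarrow> f x = g x" "Ck_on k S f"
  shows "Ck_on k S g"
  using assms(2,3)
proof (induction k arbitrary: f g)
  case 0
  then show ?case by (simp cong: continuous_on_cong)
next
  case (Suc k)
  have iff: "(f has_derivative D) (at x) \<longleftrightarrow> (g has_derivative D) (at x)" if "x \<in> S" for x D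
    using Suc.prems(1) that assms(1)
    by (metis has_derivative_transform_within_open)
  have "frechet_derivative f (at x) = frechet_derivative g (at x)" if "x \<in> S" for x
    unfolding frechet_derivative_def using iff[OF that] by simp
  then have "Ck_on k S (\<lambda>x. frechet_derivative g (at x) w)" for w
    using Suc.IH[of "\<lambda>x. frechet_derivative f (at x) w" "\<lambda>x. frechet_derivative g (at x) w"]
      Suc.prems(2) by auto
  then show ?case
    using Suc.prems(2) iff by (auto simp: differentiable_def)
qed

lemma Ck_on_subset: "Ck_on k S f \<Longrightarrow> T \<subseteq> S \<Longrightarrow> Ck_on k T f"
  by (induction k arbitrary: f) (auto intro: continuous_on_subset)

lemma Ck_on_Suc_imp: "Ck_on (Suc k) S f \<Longrightarrow> Ck_on k S f"
proof (induction k arbitrary: f)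
  case 0
  then have "continuous (at x) f" if "x \<in> S" for x
    using that by (simp add: differentiable_imp_continuous_within)
  then show ?case
    by (simp add: continuous_at_imp_continuous_on)
next
  case (Suc k)
  have "Ck_on k S (\<lambda>x. frechet_derivative f (at x) w)" for w
    by (rule Suc.IH) (use Suc.prems in \<open>simp only: Ck_on.simps, blast\<close>)
  then show ?case using Suc.prems by (simp only: Ck_on.simps) blast
qed

text \<open>\<open>frechet_derivative\<close> is defined by choice; with an explicit derivative
  \<open>D\<close> the closure proofs below only have to treat \<open>D x w\<close> for each fixed
  direction \<open>w\<close>.\<close>

lemma Ck_on_SucI:
  assumes "open S" "\<And>x. x \<in> S \<Longrightarrow> (f has_derivative D x) (at x)"
    and "\<And>w. Ck_on k S (\<lambda>x. D x w)"
  shows "Ck_on (Suc k) S f"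
proof -
  have "frechet_derivative f (at x) = D x" if "x \<in> S" for x
    using frechet_derivative_at[OF assms(2)[OF that]] by simp
  then have "Ck_on k S (\<lambda>x. frechet_derivative f (at x) w)" for w
    using Ck_on_cong_imp[OF assms(1) _ assms(3)] by auto
  then show ?thesis
    using assms(2) by (auto simp: differentiable_def)
qed

lemma Ck_on_has_derivative:
  "Ck_on (Suc k) S f \<Longrightarrow> x \<in> S \<Longrightarrow> (f has_derivative frechet_derivative f (at x)) (at x)"
  by (simp add: frechet_derivative_works)

lemma Ck_on_local:
  assumes "\<And>x. x \<in> S \<Longrightarrow> \<exists>T. open T \<and> x \<in> T \<and> Ck_on k T f"
  shows "Ck_on k S f"
  using assms
proof (induction k arbitrary: f)
  case 0
  then show ?case
    by (meson Ck_on.simps(1) continuous_at_imp_continuous_on continuous_on_eq_continuous_at)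
next
  case (Suc k)
  then show ?case by (simp; meson)
qed

lemma Ck_on_const: "Ck_on k S (\<lambda>x. a)"
  by (induction k arbitrary: a) auto

lemma Ck_on_linear:
  assumes "bounded_linear f" shows "Ck_on k S f"
proof (cases k)
  case 0
  then show ?thesis using assms by (simp add: linear_continuous_on)
next
  case (Suc j)
  have "frechet_derivative f (at x) = f" for x
    using bounded_linear_imp_has_derivative[OF assms] frechet_derivative_at by metis
  then show ?thesis
    using Suc assms by (auto simp: Ck_on_const bounded_linear_imp_differentiable)
qed

lemma Ck_on_add:
  assumes "open S" "Ck_on k S f" "Ck_on k S g"
  shows "Ck_on k S (\<lambda>x. f x + g x)"
  using assms(2,3)
proof (induction k arbitrary: f g)
  case 0
  then show ?case by (simp add: continuous_on_add)
next
  case (Suc k)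
  show ?case
    by (rule Ck_on_SucI[OF assms(1)
         has_derivative_add[OF Ck_on_has_derivative[OF Suc.prems(1)] Ck_on_has_derivative[OF Suc.prems(2)]]])
       (use Suc in auto)
qed

text \<open>The product rule yields products of one differentiated and one undifferentiated factor;
  the induction hypothesis applies once the latter is lowered by \<open>Ck_on_Suc_imp\<close>. The
  locale serves real multiplication, scaling and inner products alike.\<close>

lemma (in bounded_bilinear) Ck_on:
  assumes "open S" "Ck_on k S f" "Ck_on k S g"
  shows "Ck_on k S (\<lambda>x. prod (f x) (g x))"
  using assms(2,3)
proof (induction k arbitrary: f g)
  case 0
  then show ?case by (simp add: continuous_on)
next
  case (Suc k)
  show ?case
    by (rule Ck_on_SucI[OF assms(1)
         FDERIV[OF Ck_on_has_derivative[OF Suc.prems(1)] Ck_on_has_derivative[OF Suc.prems(2)]]])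
       (assumption+, intro Ck_on_add[OF assms(1)] Suc.IH Ck_on_Suc_imp[OF Suc.prems(1)]
         Ck_on_Suc_imp[OF Suc.prems(2)], use Suc.prems in auto)
qed

lemma Ck_on_sum:
  assumes "open S" "\<And>i. i \<in> I \<Longrightarrow> Ck_on k S (f i)"
  shows "Ck_on k S (\<lambda>x. \<Sum>i\<in>I. f i x)"
  using assms(2)
  by (induction I rule: infinite_finite_induct) (auto intro: Ck_on_const Ck_on_add[OF assms(1)])

lemma Ck_on_bounded_linear:
  assumes "open S" "bounded_linear h" "Ck_on k S f"
  shows "Ck_on k S (\<lambda>x. h (f x))"
  using assms(3)
proof (induction k arbitrary: f)
  case 0
  then show ?case by (simp add: bounded_linear.continuous_on[OF assms(2)])
next
  case (Suc k)
  show ?case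
    by (rule Ck_on_SucI[OF assms(1)
         bounded_linear.has_derivative[OF assms(2) Ck_on_has_derivative[OF Suc.prems(1)]]])
       (use Suc in auto)
qed

text \<open>\<open>Ck_on\<close> speaks of derivatives in fixed directions only; this expansion
  reduces a direction that moves with the point to finitely many fixed ones.\<close>

lemma frechet_derivative_sum_Basis:
  fixes f :: "'e::euclidean_space \<Rightarrow> 'f::real_normed_vector"
  assumes "f differentiable (at x)"
  shows "frechet_derivative f (at x) w = (\<Sum>b\<in>Basis. (w \<bullet> b) *\<^sub>R frechet_derivative f (at x) b)"
proof -
  have "linear (frechet_derivative f (at x))"
    using assms by (simp add: linear_frechet_derivative)
  then show ?thesis
    by (subst euclidean_representation[of w, symmetric])
       (simp add: linear_sum linear_scale del: euclidean_representation)
qed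

text \<open>In the chain rule the direction in which \<open>f\<close> is differentiated depends on
  the point. After expansion in the basis only partial derivatives of \<open>f\<close> composed with
  \<open>g\<close> remain, and these are covered by the induction hypothesis because
  \<open>f\<close> is arbitrary in it.\<close>

lemma Ck_on_compose:
  fixes f :: "'e::euclidean_space \<Rightarrow> 'f::real_normed_vector"
  assumes "open S" "open T" "Ck_on k T f" "Ck_on k S g" "g ` S \<subseteq> T"
  shows "Ck_on k S (\<lambda>x. f (g x))"
  using assms(3,4)
proof (induction k arbitrary: f)
  case 0
  then show ?case using assms(5) by (auto intro: continuous_on_compose2)
next
  case (Suc k)
  have g: "Ck_on k S g" using Suc.prems(2) by (rule Ck_on_Suc_imp)
  show ?case
  proof (rule Ck_on_SucI[OF assms(1)])
    fix x assume x: "x \<in> S"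
    let ?D = "\<lambda>w. \<Sum>b\<in>Basis. (frechet_derivative g (at x) w \<bullet> b) *\<^sub>R frechet_derivative f (at (g x)) b"
    have fx: "f differentiable (at (g x))" using Suc.prems(1) x assms(5) by auto
    have "((\<lambda>x. f (g x)) has_derivative (\<lambda>w. frechet_derivative f (at (g x)) (frechet_derivative g (at x) w))) (at x)"
      using has_derivative_compose[OF Ck_on_has_derivative[OF Suc.prems(2) x]] fx
      by (simp add: frechet_derivative_works)
    then show "((\<lambda>x. f (g x)) has_derivative ?D) (at x)"
      by (subst (asm) frechet_derivative_sum_Basis[OF fx])
  next
    fix w
    show "Ck_on k S (\<lambda>x. \<Sum>b\<in>Basis. (frechet_derivative g (at x) w \<bullet> b) *\<^sub>R frechet_derivative f (at (g x)) b)"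
      using Suc.prems g
      by (intro Ck_on_sum assms(1) bounded_bilinear.Ck_on[OF bounded_bilinear_scaleR]
          Ck_on_bounded_linear[OF assms(1) bounded_linear_inner_left] Suc.IH) auto
  qed
qed

section \<open>Smooth maps, as maps of every order of differentiability\<close>

lemma smooth_on_cong:
  assumes "open S" "\<And>x. x \<in> S \<Longrightarrow> f x = g x"
  shows "smooth_on S f \<longleftrightarrow> smooth_on S g"
  unfolding smooth_on_def using Ck_on_cong_imp[OF assms(1)] assms(2) by metis

lemma smooth_on_subset: "smooth_on S f \<Longrightarrow> T \<subseteq> S \<Longrightarrow> smooth_on T f"
  unfolding smooth_on_def using Ck_on_subset by blast

lemma smooth_on_local:
  assumes "\<And>x. x \<in> S \<Longrightarrow> \<exists>T. open T \<and> x \<in> T \<and> smooth_on T f"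
  shows "smooth_on S f"
  unfolding smooth_on_def by (meson Ck_on_local assms smooth_on_def)

lemma smooth_on_const: "smooth_on S (\<lambda>x. a)"
  by (simp add: smooth_on_def Ck_on_const)

lemma smooth_on_linear: "bounded_linear f \<Longrightarrow> smooth_on S f"
  by (simp add: smooth_on_def Ck_on_linear)

lemma smooth_on_add:
  "open S \<Longrightarrow> smooth_on S f \<Longrightarrow> smooth_on S g \<Longrightarrow> smooth_on S (\<lambda>x. f x + g x)"
  by (simp add: smooth_on_def Ck_on_add)

lemma smooth_on_sum:
  "open S \<Longrightarrow> (\<And>i. i \<in> I \<Longrightarrow> smooth_on S (f i)) \<Longrightarrow> smooth_on S (\<lambda>x. \<Sum>i\<in>I. f i x)"
  by (simp add: smooth_on_def Ck_on_sum)

lemma smooth_on_mult: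
  fixes f g :: "_ \<Rightarrow> real"
  shows "open S \<Longrightarrow> smooth_on S f \<Longrightarrow> smooth_on S g \<Longrightarrow> smooth_on S (\<lambda>x. f x * g x)"
  by (simp add: smooth_on_def bounded_bilinear.Ck_on[OF bounded_bilinear_mult])

lemma smooth_on_scaleR:
  "open S \<Longrightarrow> smooth_on S f \<Longrightarrow> smooth_on S g \<Longrightarrow> smooth_on S (\<lambda>x. f x *\<^sub>R g x)"
  by (simp add: smooth_on_def bounded_bilinear.Ck_on[OF bounded_bilinear_scaleR])

lemma smooth_on_bounded_linear:
  "open S \<Longrightarrow> bounded_linear h \<Longrightarrow> smooth_on S f \<Longrightarrow> smooth_on S (\<lambda>x. h (f x))"
  by (simp add: smooth_on_def Ck_on_bounded_linear)

lemma smooth_on_compose: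
  fixes f :: "'e::euclidean_space \<Rightarrow> 'f::real_normed_vector"
  assumes "open S" "open T" "smooth_on T f" "smooth_on S g" "g ` S \<subseteq> T"
  shows "smooth_on S (\<lambda>x. f (g x))"
  using assms by (auto simp: smooth_on_def intro: Ck_on_compose)

lemma smooth_on_componentwise:
  fixes f :: "_ \<Rightarrow> 'f::euclidean_space"
  assumes "open S" "\<And>b. b \<in> Basis \<Longrightarrow> smooth_on S (\<lambda>x. f x \<bullet> b)"
  shows "smooth_on S f"
proof -
  have "smooth_on S (\<lambda>x. \<Sum>b\<in>Basis. (f x \<bullet> b) *\<^sub>R b)"
    by (intro smooth_on_sum smooth_on_scaleR assms smooth_on_const)
  then show ?thesis by (simp add: euclidean_representation)
qed

lemma smooth_on_Pair:
  assumes "open S" "smooth_on S f" "smooth_on S g"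
  shows "smooth_on S (\<lambda>x. (f x, g x))"
proof -
  have "smooth_on S (\<lambda>x. (f x, 0) + (0, g x))"
    by (intro smooth_on_add assms(1)
        smooth_on_bounded_linear[OF assms(1) bounded_linear_Pair[OF bounded_linear_ident bounded_linear_zero] assms(2)]
        smooth_on_bounded_linear[OF assms(1) bounded_linear_Pair[OF bounded_linear_zero bounded_linear_ident] assms(3)])
  then show ?thesis by simp
qed

lemma smooth_on_differentiable: "smooth_on S f \<Longrightarrow> x \<in> S \<Longrightarrow> f differentiable (at x)"
  unfolding smooth_on_def using Ck_on.simps(2) by blast

lemma smooth_on_has_derivative:
  "smooth_on S f \<Longrightarrow> x \<in> S \<Longrightarrow> (f has_derivative frechet_derivative f (at x)) (at x)"
  using frechet_derivative_works smooth_on_differentiable by blast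

lemma smooth_on_frechet_derivative:
  "smooth_on S f \<Longrightarrow> smooth_on S (\<lambda>x. frechet_derivative f (at x) w)"
  unfolding smooth_on_def using Ck_on.simps(2) by blast

lemma smooth_on_frechet_derivative_apply:
  fixes f :: "'e::euclidean_space \<Rightarrow> 'f::real_normed_vector"
  assumes "open S" "open T" "smooth_on T f" "smooth_on S g" "g ` S \<subseteq> T" "smooth_on S v"
  shows "smooth_on S (\<lambda>x. frechet_derivative f (at (g x)) (v x))"
proof -
  have "smooth_on S (\<lambda>x. \<Sum>b\<in>Basis. (v x \<bullet> b) *\<^sub>R frechet_derivative f (at (g x)) b)"
    by (intro smooth_on_sum smooth_on_scaleR assms(1)
        smooth_on_bounded_linear[OF assms(1) bounded_linear_inner_left assms(6)]
        smooth_on_compose[OF assms(1,2) _ assms(4,5)] smooth_on_frechet_derivative assms(3))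
  moreover have "(\<Sum>b\<in>Basis. (v x \<bullet> b) *\<^sub>R frechet_derivative f (at (g x)) b) =
      frechet_derivative f (at (g x)) (v x)" if "x \<in> S" for x
    using frechet_derivative_sum_Basis smooth_on_differentiable[OF assms(3)] assms(5) that
    by (metis image_subset_iff)
  ultimately show ?thesis
    by (subst smooth_on_cong[OF assms(1), symmetric]) auto
qed

text \<open>The derivative of \<open>inverse\<close> in a fixed direction is a constant times the
  product of \<open>inverse\<close> with itself, so the bilinear rule closes the induction.\<close>

lemma Ck_on_inverse: "Ck_on k (-{0::real}) inverse"
proof (induction k)
  case 0
  then show ?case by (simp add: continuous_on_inverse continuous_on_id)
next
  case (Suc k)
  have op: "open (-{0::real})" by auto
  show ?case
  proof (rule Ck_on_SucI[OF op])
    show "(inverse has_derivative (\<lambda>w. - (inverse x * w * inverse x))) (at x)"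
      if "x \<in> -{0}" for x :: real
      using that by (intro has_derivative_inverse') auto
    have "Ck_on k (-{0::real}) (\<lambda>x. (- w) * (inverse x * inverse x))" for w
      by (intro bounded_bilinear.Ck_on[OF bounded_bilinear_mult] op Ck_on_const Suc)
    then show "Ck_on k (-{0::real}) (\<lambda>x. - (inverse x * w * inverse x))" for w
      by (simp add: mult.assoc mult.left_commute)
  qed
qed

lemma smooth_on_inverse:
  fixes f :: "_ \<Rightarrow> real"
  assumes "open S" "smooth_on S f" "\<And>x. x \<in> S \<Longrightarrow> f x \<noteq> 0"
  shows "smooth_on S (\<lambda>x. inverse (f x))"
proof (rule smooth_on_compose[OF assms(1) _ _ assms(2)])
  show "open (-{0::real})" by auto
  show "smooth_on (-{0::real}) inverse" by (simp add: smooth_on_def Ck_on_inverse)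
  show "f ` S \<subseteq> -{0}" using assms(3) by auto
qed

section \<open>Smooth linear systems, bump functions and Hadamard's lemma\<close>

text \<open>The \<open>K b\<close> are the columns of a square matrix, for which a trivial kernel
  already means invertibility.\<close>

lemma inj_columns_inverse:
  fixes K :: "'e::euclidean_space \<Rightarrow> 'e"
  assumes "\<And>v. (\<Sum>b\<in>Basis. (v \<bullet> b) *\<^sub>R K b) = 0 \<Longrightarrow> v = 0"
  obtains N where "linear N" "\<And>v. N (\<Sum>b\<in>Basis. (v \<bullet> b) *\<^sub>R K b) = v"
    "\<And>w. (\<Sum>b\<in>Basis. (N w \<bullet> b) *\<^sub>R K b) = w"
proof -
  let ?M = "\<lambda>v. \<Sum>b\<in>Basis. (v \<bullet> b) *\<^sub>R K b"
  have lin: "linear ?M"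
    by (rule linearI) (simp_all add: inner_add_left scaleR_add_left sum.distrib scaleR_sum_right)
  have inj: "inj ?M"
    using assms linear_injective_0[OF lin] by blast
  obtain N where N: "linear N" "\<And>v. ?M (N v) = v" "\<And>v. N (?M v) = v"
    using linear_injective_isomorphism[OF lin inj] by blast
  show thesis by (rule that[OF N(1) N(3) N(2)])
qed

text \<open>The solution is read off the inverse of \<open>(y, v) \<mapsto> (y, M y v)\<close>, which is differentiable by the
  inverse function theorem; its derivatives solve linear systems with the same matrix.\<close>

lemma linear_solution_continuous_differentiable:
  fixes K :: "'e::euclidean_space \<Rightarrow> 'z::euclidean_space \<Rightarrow> 'e"
  assumes S: "open S" and K: "\<And>b. b \<in> Basis \<Longrightarrow> smooth_on S (K b)"
    and inj: "\<And>z v. z \<in> S \<Longrightarrow> (\<Sum>b\<in>Basis. (v \<bullet> b) *\<^sub>R K b z) = 0 \<Longrightarrow> v = 0"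
    and sol: "\<And>z. z \<in> S \<Longrightarrow> (\<Sum>b\<in>Basis. (a z \<bullet> b) *\<^sub>R K b z) = r z"
    and z: "z \<in> S"
  shows "continuous (at z) r \<Longrightarrow> continuous (at z) a"
    and "r differentiable (at z) \<Longrightarrow> a differentiable (at z)"
proof -
  let ?M = "\<lambda>z v. \<Sum>b\<in>Basis. (v \<bullet> b) *\<^sub>R K b z"
  have "\<exists>N. linear N \<and> (\<forall>v. N (?M y v) = v) \<and> (\<forall>w. ?M y (N w) = w)" if y: "y \<in> S" for y
    by (rule inj_columns_inverse[of "\<lambda>b. K b y"]) (use inj[OF y] in blast)+
  then obtain N where N: "linear (N y)" "N y (?M y v) = v" "?M y (N y w) = w" if "y \<in> S" for y v w
    by metis
  let ?F = "\<lambda>(y, v). (y, ?M y v)"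
  let ?G = "\<lambda>(y, w). (y, N y w)"
  let ?D = "\<lambda>(dz, dv). (dz, (\<Sum>b\<in>Basis. (a z \<bullet> b) *\<^sub>R frechet_derivative (K b) (at z) dz
               + (dv \<bullet> b) *\<^sub>R K b z))"
  let ?E = "\<lambda>(dz, dw). (dz, N z (dw - (\<Sum>b\<in>Basis. (a z \<bullet> b) *\<^sub>R frechet_derivative (K b) (at z) dz)))"
  have op: "open (S \<times> (UNIV :: 'e set))" by (simp add: S open_Times)
  have "smooth_on (S \<times> UNIV) ?F"
    unfolding split_beta
    by (intro smooth_on_Pair op smooth_on_linear bounded_linear_fst smooth_on_sum smooth_on_scaleR
        smooth_on_compose[OF op S K] bounded_linear_inner_left[THEN bounded_linear_compose]
        bounded_linear_snd) auto
  then have cont: "continuous_on (S \<times> UNIV) ?F"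
    unfolding smooth_on_def using Ck_on.simps(1) by blast
  have derK: "(K b has_derivative frechet_derivative (K b) (at z)) (at z)" if "b \<in> Basis" for b
    using smooth_on_has_derivative[OF K[OF that] z] .
  have "((\<lambda>p. (fst p, \<Sum>b\<in>Basis. (snd p \<bullet> b) *\<^sub>R K b (fst p))) has_derivative
      (\<lambda>h. (fst h, \<Sum>b\<in>Basis. (a z \<bullet> b) *\<^sub>R frechet_derivative (K b) (at z) (fst h)
               + (snd h \<bullet> b) *\<^sub>R K b z))) (at (z, a z))"
    by (auto intro!: derivative_eq_intros has_derivative_compose[of fst fst _ _ "K _"] derK)
  then have derF: "(?F has_derivative ?D) (at (z, a z))"
    by (simp add: case_prod_unfold)
  \<comment> \<open>\<open>?D\<close> is block triangular with diagonal blocks the identity and the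
    matrix at \<open>z\<close>; \<open>?E\<close> is its inverse by back substitution with
    \<open>N z\<close>.\<close>
  have inv: "?D \<circ> ?E = id"
    by (auto simp: fun_eq_iff sum.distrib N(3)[OF z])
  have gf: "?G (?F x) = x" if "x \<in> S \<times> UNIV" for x
    using that N(2) by (auto simp: split_beta)
  have derG: "(?G has_derivative ?E) (at (z, r z))"
    using has_derivative_inverse_strong[OF op _ cont gf derF inv] z sol[OF z] by simp
  have aG: "snd (?G (y, r y)) = a y" if "y \<in> S" for y
    using N(2)[OF that, of "a y"] sol[OF that] by simp
  show "continuous (at z) a" if r: "continuous (at z) r"
  proof -
    have "continuous (at z) (\<lambda>y. ?G (y, r y))"
      by (rule continuous_at_compose[of _ "\<lambda>y. (y, r y)" ?G, unfolded o_def])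
         (use r has_derivative_continuous[OF derG] in \<open>auto intro: continuous_Pair\<close>)
    then have "continuous (at z) (\<lambda>y. snd (?G (y, r y)))"
      by (rule continuous_snd)
    then show ?thesis
      by (rule continuous_transform_within_openin[of z UNIV, simplified])
         (use S z aG in \<open>auto\<close>)
  qed
  show "a differentiable (at z)" if r: "r differentiable (at z)"
  proof -
    obtain r' where r': "(r has_derivative r') (at z)" using r by (auto simp: differentiable_def)
    have "((\<lambda>y. ?G (y, r y)) has_derivative (\<lambda>h. ?E (h, r' h))) (at z)"
      by (rule has_derivative_compose[of "\<lambda>y. (y, r y)" "\<lambda>h. (h, r' h)"])
         (use derG r' in \<open>auto intro: has_derivative_Pair\<close>)
    then have "((\<lambda>y. snd (?G (y, r y))) has_derivative (\<lambda>h. snd (?E (h, r' h)))) (at z)"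
      by (rule has_derivative_snd)
    then have "(a has_derivative (\<lambda>h. snd (?E (h, r' h)))) (at z)"
      by (rule has_derivative_transform_within_open[OF _ S z]) (rule aG)
    then show ?thesis by (auto simp: differentiable_def)
  qed
qed

text \<open>Regularity is gained one order at a time. Differentiating \<open>sol\<close> in a
  direction gives a system with the same columns for the derivative of \<open>a\<close>, whose
  right-hand side contains derivatives of \<open>r\<close> and \<open>K\<close> but \<open>a\<close>
  itself undifferentiated. So the right-hand side has order \<open>k\<close> as soon as
  \<open>a\<close> does, and the induction hypothesis is used for \<open>a\<close> first and then
  for its derivative.\<close>

lemma smooth_on_linear_solution:
  fixes K :: "'e::euclidean_space \<Rightarrow> 'z::euclidean_space \<Rightarrow> 'e"
  assumes S: "open S" and K: "\<And>b. b \<in> Basis \<Longrightarrow> smooth_on S (K b)"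
    and inj: "\<And>z v. z \<in> S \<Longrightarrow> (\<Sum>b\<in>Basis. (v \<bullet> b) *\<^sub>R K b z) = 0 \<Longrightarrow> v = 0"
    and r: "smooth_on S r"
    and sol: "\<And>z. z \<in> S \<Longrightarrow> (\<Sum>b\<in>Basis. (a z \<bullet> b) *\<^sub>R K b z) = r z"
  shows "smooth_on S a"
proof -
  have "Ck_on k S a"
    if "Ck_on k S r" "\<And>z. z \<in> S \<Longrightarrow> (\<Sum>b\<in>Basis. (a z \<bullet> b) *\<^sub>R K b z) = r z" for k a r
    using that
  proof (induction k arbitrary: a r)
    case 0
    then have "continuous (at z) a" if "z \<in> S" for z
      using linear_solution_continuous_differentiable(1)[OF S K inj 0(2) that] 0(1) that S
      by (simp add: continuous_on_eq_continuous_at)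
    then show ?case by (simp add: continuous_at_imp_continuous_on)
  next
    case (Suc k)
    have a: "Ck_on k S a" using Suc.IH[OF Ck_on_Suc_imp[OF Suc.prems(1)] Suc.prems(2)] by simp
    have r: "r differentiable (at z)" if "z \<in> S" for z using Suc.prems(1) that by simp
    have da: "a differentiable (at z)" if z: "z \<in> S" for z
      using linear_solution_continuous_differentiable(2)[OF S K inj Suc.prems(2) z r[OF z]] by simp
    have Kk: "Ck_on k S (K b)" "Ck_on k S (\<lambda>z. frechet_derivative (K b) (at z) w)"
      if "b \<in> Basis" for b w
      using K[OF that] smooth_on_frechet_derivative[OF K[OF that]] unfolding smooth_on_def by auto
    have "Ck_on k S (\<lambda>z. frechet_derivative a (at z) w)" for w
    proof (rule Suc.IH)
      have "Ck_on k S (\<lambda>z. frechet_derivative r (at z) w + (-1) *\<^sub>R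
          (\<Sum>b\<in>Basis. (a z \<bullet> b) *\<^sub>R frechet_derivative (K b) (at z) w))"
        using Suc.prems(1)
        by (intro Ck_on_add S Ck_on_sum bounded_bilinear.Ck_on[OF bounded_bilinear_scaleR] Kk
            Ck_on_bounded_linear[OF S bounded_linear_inner_left a] Ck_on_const) auto
      then show "Ck_on k S (\<lambda>z. frechet_derivative r (at z) w -
          (\<Sum>b\<in>Basis. (a z \<bullet> b) *\<^sub>R frechet_derivative (K b) (at z) w))" by simp
      fix z assume z: "z \<in> S"
      have "((\<lambda>z. \<Sum>b\<in>Basis. (a z \<bullet> b) *\<^sub>R K b z) has_derivative
          (\<lambda>w. \<Sum>b\<in>Basis. (a z \<bullet> b) *\<^sub>R frechet_derivative (K b) (at z) w
              + (frechet_derivative a (at z) w \<bullet> b) *\<^sub>R K b z)) (at z)"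
        using da[OF z] smooth_on_has_derivative[OF K z]
        by (intro has_derivative_sum has_derivative_scaleR has_derivative_inner_left)
           (auto simp: frechet_derivative_works)
      then have "(r has_derivative
          (\<lambda>w. \<Sum>b\<in>Basis. (a z \<bullet> b) *\<^sub>R frechet_derivative (K b) (at z) w
              + (frechet_derivative a (at z) w \<bullet> b) *\<^sub>R K b z)) (at z)"
        by (rule has_derivative_transform_within_open[OF _ S z]) (rule Suc.prems(2))
      from frechet_derivative_at[OF this, symmetric]
      show "(\<Sum>b\<in>Basis. (frechet_derivative a (at z) w \<bullet> b) *\<^sub>R K b z) =
        frechet_derivative r (at z) w - (\<Sum>b\<in>Basis. (a z \<bullet> b) *\<^sub>R frechet_derivative (K b) (at z) w)"
        by (simp add: sum.distrib)
    qed
    then show ?case using da by simp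
  qed
  then show ?thesis using r sol unfolding smooth_on_def by blast
qed

section \<open>Flat functions and smooth bumps\<close>

definition exp_flat :: "nat \<Rightarrow> real \<Rightarrow> real" where
  "exp_flat n t = (if t > 0 then inverse t ^ n / exp (inverse t) else 0)"

lemma exp_flat_tendsto_0: "(exp_flat n \<longlongrightarrow> 0) (at 0)"
proof (rule filterlim_split_at)
  show "(exp_flat n \<longlongrightarrow> 0) (at_left 0)"
    by (rule tendsto_eventually) (auto simp: exp_flat_def eventually_at_filter)
  have "((\<lambda>t. inverse t ^ n / exp (inverse t)) \<longlongrightarrow> 0) (at_right (0::real))"
    by (rule filterlim_compose[OF tendsto_power_div_exp_0 filterlim_inverse_at_top_right])
  then show "(exp_flat n \<longlongrightarrow> 0) (at_right 0)"
    by (rule Lim_transform_eventually) (auto simp: exp_flat_def eventually_at_filter)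
qed

text \<open>The members are t^(-n) exp(-1/t) continued by 0. All powers are carried along because
  the whole family, unlike \<open>exp_flat 0\<close> alone, is closed under differentiation up to
  linear combinations.\<close>

lemma exp_flat_has_derivative:
  "(exp_flat n has_field_derivative exp_flat (n + 2) t - n * exp_flat (n + 1) t) (at t)"
proof -
  consider "t > 0" | "t = 0" | "t < 0" by linarith
  then show ?thesis
  proof cases
    case 1
    have "((\<lambda>t. inverse t ^ n) has_field_derivative - n * inverse t ^ (n + 1)) (at t)"
      using DERIV_power[OF DERIV_inverse[of t UNIV], of n] 1 by (cases n) (auto simp: algebra_simps)
    moreover have "((\<lambda>t. exp (- inverse t)) has_field_derivative exp (- inverse t) * (inverse t)\<^sup>2) (at t)"
      using 1 by (auto intro!: derivative_eq_intros simp: field_simps power2_eq_square)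
    ultimately have "((\<lambda>t. inverse t ^ n * exp (- inverse t)) has_field_derivative
        (- n * inverse t ^ (n + 1)) * exp (- inverse t) + exp (- inverse t) * (inverse t)\<^sup>2 * inverse t ^ n) (at t)"
      by (rule DERIV_mult)
    then have "((\<lambda>t. inverse t ^ n / exp (inverse t)) has_field_derivative
        exp_flat (n + 2) t - n * exp_flat (n + 1) t) (at t)"
      using 1 by (simp add: exp_flat_def exp_minus divide_inverse power_add power2_eq_square algebra_simps)
    then show ?thesis
      by (rule has_field_derivative_transform_within_open[of _ _ _ "{0<..}"])
         (use 1 in \<open>auto simp: exp_flat_def\<close>)
  next
    case 2
    \<comment> \<open>At 0 the difference quotient of \<open>exp_flat n\<close> is
      \<open>exp_flat (Suc n)\<close>: division by \<open>y\<close> only adds one power of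
      \<open>inverse y\<close>.\<close>
    have "((\<lambda>y. (exp_flat n y - exp_flat n 0) / (y - 0)) \<longlongrightarrow> 0) (at 0)"
      by (rule Lim_transform_eventually[OF exp_flat_tendsto_0[of "Suc n"]])
         (auto simp: exp_flat_def eventually_at_filter field_simps)
    then show ?thesis using 2 by (simp add: has_field_derivative_iff exp_flat_def)
  next
    case 3
    have "((\<lambda>t. 0) has_field_derivative exp_flat (n + 2) t - n * exp_flat (n + 1) t) (at t)"
      using 3 by (simp add: exp_flat_def)
    then show ?thesis
      by (rule has_field_derivative_transform_within_open[of _ _ _ "{..<0}"])
         (use 3 in \<open>auto simp: exp_flat_def\<close>)
  qed
qed

lemma smooth_on_exp_flat: "smooth_on UNIV (exp_flat n)"
proof -
  have "Ck_on k UNIV (exp_flat n)" for k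
  proof (induction k arbitrary: n)
    case 0
    have "isCont (exp_flat n) t" for t
      by (rule DERIV_isCont[OF exp_flat_has_derivative])
    then show ?case by (simp add: continuous_at_imp_continuous_on)
  next
    case (Suc k)
    show ?case
    proof (rule Ck_on_SucI)
      show "(exp_flat n has_derivative (\<lambda>w. (exp_flat (n + 2) t - n * exp_flat (n + 1) t) * w)) (at t)" for t
        using exp_flat_has_derivative by (simp add: has_field_derivative_def)
      have "Ck_on k UNIV (\<lambda>t. (exp_flat (n + 2) t + (- real n) * exp_flat (n + 1) t) * w)" for w
        by (intro bounded_bilinear.Ck_on[OF bounded_bilinear_mult] Ck_on_add Ck_on_const Suc) auto
      then show "Ck_on k UNIV (\<lambda>t. (exp_flat (n + 2) t - n * exp_flat (n + 1) t) * w)" for w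
        by simp
    qed simp
  qed
  then show ?thesis by (simp add: smooth_on_def)
qed

text \<open>The quotient e(t) / (e(t) + e(1 - t)) with e = \<open>exp_flat 0\<close>. One of
  \<open>t\<close> and \<open>1 - t\<close> is always positive, so the denominator never
  vanishes.\<close>

lemma smooth_step_exists:
  "\<exists>f :: real \<Rightarrow> real. smooth_on UNIV f \<and> (\<forall>t\<le>0. f t = 0) \<and> (\<forall>t\<ge>1. f t = 1)"
proof (intro exI conjI allI impI)
  let ?f = "\<lambda>t. exp_flat 0 t * inverse (exp_flat 0 t + exp_flat 0 (1 - t))"
  have pos: "exp_flat 0 t + exp_flat 0 (1 - t) \<noteq> 0" for t
    by (auto simp: exp_flat_def add_pos_pos intro!: less_imp_neq[THEN not_sym] add_pos_pos)
  have "smooth_on UNIV (\<lambda>t::real. 1 + (-1) *\<^sub>R t)"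
    by (intro smooth_on_add smooth_on_const smooth_on_scaleR smooth_on_linear bounded_linear_ident
        open_UNIV)
  then have "smooth_on UNIV (\<lambda>t. exp_flat 0 (1 - t))"
    using smooth_on_compose[OF open_UNIV open_UNIV smooth_on_exp_flat] by fastforce
  then show "smooth_on UNIV ?f"
    by (intro smooth_on_mult smooth_on_inverse smooth_on_add smooth_on_exp_flat pos) auto
qed (auto simp: exp_flat_def)

lemma smooth_bump_exists:
  fixes x0 :: "'e::euclidean_space"
  assumes "r > 0"
  obtains \<psi> :: "'e \<Rightarrow> real" where "smooth_on UNIV \<psi>"
    "\<And>x. x \<in> ball x0 (r / 3) \<Longrightarrow> \<psi> x = 1" "\<And>x. x \<notin> cball x0 (r / 2) \<Longrightarrow> \<psi> x = 0"
proof -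
  obtain f :: "real \<Rightarrow> real" where f: "smooth_on UNIV f" "\<And>t. t \<le> 0 \<Longrightarrow> f t = 0" "\<And>t. t \<ge> 1 \<Longrightarrow> f t = 1"
    using smooth_step_exists by blast
  \<comment> \<open>The constants make \<open>?g\<close> equal to 0 at distance \<open>r / 2\<close>
    from \<open>x0\<close> and to 10/9 at distance \<open>r / 3\<close>, so that the step function
    is 0 outside the larger ball and 1 inside the smaller one.\<close>
  let ?g = "\<lambda>x. 2 + (- (8 / r\<^sup>2)) *\<^sub>R ((x - x0) \<bullet> (x - x0))"
  have d: "smooth_on UNIV (\<lambda>x. x + (- x0))"
    by (intro smooth_on_add smooth_on_linear smooth_on_const) auto
  have "smooth_on UNIV (\<lambda>x. (x - x0) \<bullet> (x - x0))"
    using d unfolding smooth_on_def by (simp add: bounded_bilinear.Ck_on[OF bounded_bilinear_inner])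
  then have "smooth_on UNIV (\<lambda>x. f (?g x))"
    by (intro smooth_on_compose[OF _ open_UNIV f(1)] smooth_on_add smooth_on_scaleR smooth_on_const) auto
  moreover have "f (?g x) = 1" if "x \<in> ball x0 (r / 3)" for x
  proof (rule f(3))
    have "norm (x - x0) \<le> r / 3" using that by (simp add: dist_norm norm_minus_commute)
    then have "(norm (x - x0))\<^sup>2 \<le> (r / 3)\<^sup>2" by (intro power_mono) auto
    then have "(8 / r\<^sup>2) * (norm (x - x0))\<^sup>2 \<le> (8 / r\<^sup>2) * (r / 3)\<^sup>2"
      by (intro mult_left_mono) auto
    also have "\<dots> \<le> 1" using assms by (simp add: power_divide)
    finally show "?g x \<ge> 1" by (simp add: power2_norm_eq_inner)
  qed
  moreover have "f (?g x) = 0" if "x \<notin> cball x0 (r / 2)" for x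
  proof (rule f(2))
    have "norm (x - x0) \<ge> r / 2" using that by (simp add: dist_norm norm_minus_commute)
    then have "(norm (x - x0))\<^sup>2 \<ge> (r / 2)\<^sup>2" using assms by (intro power_mono) auto
    then have "(8 / r\<^sup>2) * (norm (x - x0))\<^sup>2 \<ge> (8 / r\<^sup>2) * (r / 2)\<^sup>2"
      by (intro mult_left_mono) auto
    moreover have "(8 / r\<^sup>2) * (r / 2)\<^sup>2 = 2" using assms by (simp add: power_divide)
    ultimately show "?g x \<le> 0" by (simp add: power2_norm_eq_inner)
  qed
  ultimately show thesis by (rule that)
qed

text \<open>The ball of radius \<open>r\<close> and the complement of the closed ball of radius
  \<open>\<delta>\<close> are open and cover the space because \<open>\<delta> < r\<close>; the
  function is a product on the first and 0 on the second.\<close>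

lemma smooth_on_bump_extension:
  fixes \<psi> g :: "'e::euclidean_space \<Rightarrow> real"
  assumes "smooth_on UNIV \<psi>" "\<And>x. x \<notin> cball x0 \<delta> \<Longrightarrow> \<psi> x = 0" "\<delta> < r" "smooth_on (ball x0 r) g"
  shows "smooth_on UNIV (\<lambda>x. if x \<in> ball x0 r then \<psi> x * g x else 0)"
proof (rule smooth_on_local)
  fix x
  let ?h = "\<lambda>x. if x \<in> ball x0 r then \<psi> x * g x else 0"
  have "smooth_on (ball x0 r) (\<lambda>x. \<psi> x * g x)"
    using assms by (intro smooth_on_mult) (auto intro: smooth_on_subset)
  then have "smooth_on (ball x0 r) ?h"
    by (subst smooth_on_cong[of _ _ "\<lambda>x. \<psi> x * g x"]) auto
  moreover have "smooth_on (- cball x0 \<delta>) ?h"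
    by (subst smooth_on_cong[of _ _ "\<lambda>x. 0"]) (use assms(2) in \<open>auto simp: smooth_on_const\<close>)
  moreover have "x \<in> ball x0 r \<or> x \<in> - cball x0 \<delta>" using assms(3) by auto
  ultimately show "\<exists>T. open T \<and> x \<in> T \<and> smooth_on T ?h" by (meson open_ball open_Compl closed_cball)
qed

section \<open>Differentiation under the integral sign and Hadamard's lemma\<close>

lemma Ck_on_segment_integral:
  fixes \<phi> :: "'e::euclidean_space \<Rightarrow> 'f::euclidean_space"
  assumes "smooth_on (ball x0 r) \<phi>"
  shows "Ck_on n (ball x0 r) (\<lambda>x. integral {0..1} (\<lambda>t. t ^ k *\<^sub>R \<phi> (x0 + t *\<^sub>R (x - x0))))"
  using assms
proof (induction n arbitrary: k \<phi>)
  let ?B = "ball x0 r"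
  have mem: "x0 + t *\<^sub>R (x - x0) \<in> ?B" if "x \<in> ?B" "t \<in> {0..1}" for x t
  proof -
    have "norm (t *\<^sub>R (x - x0)) \<le> 1 * norm (x - x0)"
      using that(2) by (simp only: norm_scaleR) (intro mult_right_mono, auto)
    then show ?thesis using that(1) by (simp add: dist_norm norm_minus_commute)
  qed
  have cont: "continuous_on (?B \<times> cbox 0 1) (\<lambda>(x, t). t ^ k *\<^sub>R \<phi> (x0 + t *\<^sub>R (x - x0)))"
    if "continuous_on ?B \<phi>" for k and \<phi> :: "'e \<Rightarrow> 'f"
    unfolding split_beta
    by (intro continuous_intros continuous_on_compose2[OF that]) (use mem in auto)
  have sm: "continuous_on ?B \<phi>" if "smooth_on ?B \<phi>" for \<phi> :: "'e \<Rightarrow> 'f"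
    using that Ck_on.simps(1) unfolding smooth_on_def by blast
  {
    case 0
    then show ?case
      using integral_continuous_on_param[OF cont[OF sm]] by simp
  next
    case (Suc n)
    \<comment> \<open>The inner map \<open>x0 + t *\<^sub>R (x - x0)\<close> contributes a factor
      \<open>t\<close> to the derivative. This is why the statement carries the weight
      \<open>t ^ k\<close> and why \<open>k\<close> and \<open>\<phi>\<close> stay arbitrary in the
      induction. \<open>?fx\<close> is the same derivative packed as a bounded linear function, the
      form in which \<open>leibniz_rule\<close> expects it.\<close>
    let ?D = "\<lambda>x w. integral {0..1} (\<lambda>t. t ^ Suc k *\<^sub>R frechet_derivative \<phi> (at (x0 + t *\<^sub>R (x - x0))) w)"
    let ?fx = "\<lambda>x t. Blinfun (\<lambda>w. t ^ Suc k *\<^sub>R frechet_derivative \<phi> (at (x0 + t *\<^sub>R (x - x0))) w)"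
    have der: "(\<phi> has_derivative frechet_derivative \<phi> (at y)) (at y)" if "y \<in> ?B" for y
      by (rule smooth_on_has_derivative[OF Suc.prems that])
    have blf: "blinfun_apply (?fx x t) = (\<lambda>w. t ^ Suc k *\<^sub>R frechet_derivative \<phi> (at (x0 + t *\<^sub>R (x - x0))) w)"
      if "x \<in> ?B" "t \<in> {0..1}" for x t
      by (rule bounded_linear_Blinfun_apply)
         (intro bounded_linear_const_scaleR has_derivative_bounded_linear[OF der[OF mem[OF that]]])
    have contD: "continuous_on (?B \<times> cbox 0 1)
       (\<lambda>(x, t). t ^ Suc k *\<^sub>R frechet_derivative \<phi> (at (x0 + t *\<^sub>R (x - x0))) w)" for w
      by (rule cont[OF sm[OF smooth_on_frechet_derivative[OF Suc.prems]]])
    have contB: "continuous_on (?B \<times> cbox 0 1) (\<lambda>(x, t). ?fx x t)"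
    proof (rule continuous_on_blinfun_componentwise)
      fix w :: 'e
      show "continuous_on (?B \<times> cbox 0 1) (\<lambda>x. blinfun_apply (case x of (x, t) \<Rightarrow> ?fx x t) w)"
        by (rule continuous_on_cong[THEN iffD1, OF refl _ contD[of w]]) (use blf in auto)
    qed
    show ?case
    proof (rule Ck_on_SucI[where D = ?D])
      fix x assume x: "x \<in> ?B"
      have hd: "((\<lambda>x. integral (cbox 0 1) (\<lambda>t. t ^ k *\<^sub>R \<phi> (x0 + t *\<^sub>R (x - x0)))) has_derivative
          integral (cbox 0 1) (?fx x)) (at x within ?B)"
      proof (rule leibniz_rule[OF _ _ contB x])
        fix y and t :: real assume y: "y \<in> ?B" and t: "t \<in> cbox 0 1"
        have t': "t \<in> {0..1}" using t by simp
        have "((\<lambda>x. \<phi> (x0 + t *\<^sub>R (x - x0))) has_derivative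
            (\<lambda>w. frechet_derivative \<phi> (at (x0 + t *\<^sub>R (y - x0))) (t *\<^sub>R w))) (at y within ?B)"
          by (rule has_derivative_compose[where f = "\<lambda>x. x0 + t *\<^sub>R (x - x0)" and g = \<phi>, OF _ der[OF mem[OF y t']]])
             (auto intro!: derivative_eq_intros)
        then have "((\<lambda>x. t ^ k *\<^sub>R \<phi> (x0 + t *\<^sub>R (x - x0))) has_derivative
            (\<lambda>w. t ^ k *\<^sub>R frechet_derivative \<phi> (at (x0 + t *\<^sub>R (y - x0))) (t *\<^sub>R w))) (at y within ?B)"
          by (rule has_derivative_scaleR_right)
        moreover have "frechet_derivative \<phi> (at (x0 + t *\<^sub>R (y - x0))) (t *\<^sub>R w)
            = t *\<^sub>R frechet_derivative \<phi> (at (x0 + t *\<^sub>R (y - x0))) w" for w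
          using has_derivative_bounded_linear[OF der[OF mem[OF y t']]]
          by (simp add: linear_simps)
        ultimately show "((\<lambda>x. t ^ k *\<^sub>R \<phi> (x0 + t *\<^sub>R (x - x0))) has_derivative
            blinfun_apply (?fx y t)) (at y within ?B)"
          using blf[OF y t'] by (simp add: mult.commute)
      next
        fix y assume y: "y \<in> ?B"
        show "(\<lambda>t. t ^ k *\<^sub>R \<phi> (x0 + t *\<^sub>R (y - x0))) integrable_on cbox 0 1"
          by (intro integrable_continuous continuous_intros
              continuous_on_compose2[OF sm[OF Suc.prems]]) (use mem[OF y] in auto)
      qed simp
      have eq: "blinfun_apply (integral (cbox 0 1) (?fx x)) = ?D x"
      proof
        fix w
        have "?fx x integrable_on cbox 0 1"
        proof (rule integrable_continuous)
          have "continuous_on (cbox 0 1) (\<lambda>t. case (x, t) of (x, t) \<Rightarrow> ?fx x t)"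
            by (rule continuous_on_compose2[OF contB]) (use x in \<open>auto intro!: continuous_intros\<close>)
          then show "continuous_on (cbox 0 1) (?fx x)" by simp
        qed
        then have "blinfun_apply (integral (cbox 0 1) (?fx x)) w = integral (cbox 0 1) (\<lambda>t. blinfun_apply (?fx x t) w)"
          by (rule blinfun_apply_integral)
        also have "\<dots> = ?D x w"
          using blf[OF x] by (auto intro!: integral_cong)
        finally show "blinfun_apply (integral (cbox 0 1) (?fx x)) w = ?D x w" .
      qed
      show "((\<lambda>x. integral {0..1} (\<lambda>t. t ^ k *\<^sub>R \<phi> (x0 + t *\<^sub>R (x - x0)))) has_derivative ?D x) (at x)"
        using hd[unfolded eq] by (simp add: at_within_open[OF x open_ball])
    next
      fix w
      show "Ck_on n ?B (\<lambda>x. ?D x w)"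
        by (rule Suc.IH[OF smooth_on_frechet_derivative[OF Suc.prems]])
    qed simp
  }
qed

text \<open>Integrating the derivative along the segment from \<open>x0\<close> to \<open>x\<close>
  and expanding \<open>x - x0\<close> in the basis gives as coefficients the mean values of the
  partial derivatives over the segment. They are smooth by the weight \<open>k = 0\<close> of the
  preceding lemma, and at \<open>x0\<close> the integrand is constant.\<close>

lemma Hadamard_lemma:
  fixes \<phi> :: "'e::euclidean_space \<Rightarrow> real"
  assumes "smooth_on (ball x0 r) \<phi>"
  obtains G where "\<And>b. smooth_on (ball x0 r) (G b)"
    "\<And>x. x \<in> ball x0 r \<Longrightarrow> \<phi> x = \<phi> x0 + (\<Sum>b\<in>Basis. ((x - x0) \<bullet> b) * G b x)"
    "\<And>b. r > 0 \<Longrightarrow> G b x0 = frechet_derivative \<phi> (at x0) b"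
proof -
  let ?G = "\<lambda>b x. integral {0..1} (\<lambda>t. frechet_derivative \<phi> (at (x0 + t *\<^sub>R (x - x0))) b)"
  have sm: "smooth_on (ball x0 r) (?G b)" for b
    using Ck_on_segment_integral[OF smooth_on_frechet_derivative[OF assms], of _ 0 b]
    by (simp add: smooth_on_def)
  have "\<phi> x = \<phi> x0 + (\<Sum>b\<in>Basis. ((x - x0) \<bullet> b) * ?G b x)" if x: "x \<in> ball x0 r" for x
  proof -
    have mem: "x0 + t *\<^sub>R (x - x0) \<in> ball x0 r" if "t \<in> {0..1}" for t
    proof -
      have "norm (t *\<^sub>R (x - x0)) \<le> 1 * norm (x - x0)"
        using that by (simp only: norm_scaleR) (intro mult_right_mono, auto)
      then show ?thesis using x by (simp add: dist_norm norm_minus_commute)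
    qed
    have "((\<lambda>t. \<phi> (x0 + t *\<^sub>R (x - x0))) has_vector_derivative
        frechet_derivative \<phi> (at (x0 + t *\<^sub>R (x - x0))) (x - x0)) (at t within {0..1})"
      if t: "t \<in> {0..1}" for t
    proof -
      let ?d = "frechet_derivative \<phi> (at (x0 + t *\<^sub>R (x - x0)))"
      note d = smooth_on_has_derivative[OF assms mem[OF t]]
      have "((\<lambda>t. \<phi> (x0 + t *\<^sub>R (x - x0))) has_derivative (\<lambda>h. ?d (h *\<^sub>R (x - x0)))) (at t within {0..1})"
        by (rule has_derivative_compose[where f = "\<lambda>t. x0 + t *\<^sub>R (x - x0)" and g = \<phi>, OF _ d]) (auto intro!: derivative_eq_intros)
      moreover have "?d (h *\<^sub>R (x - x0)) = h *\<^sub>R ?d (x - x0)" for h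
        using has_derivative_bounded_linear[OF d] by (simp only: linear_simps)
      ultimately show ?thesis by (simp add: has_vector_derivative_def)
    qed
    then have "((\<lambda>t. frechet_derivative \<phi> (at (x0 + t *\<^sub>R (x - x0))) (x - x0)) has_integral
        \<phi> (x0 + 1 *\<^sub>R (x - x0)) - \<phi> (x0 + 0 *\<^sub>R (x - x0))) {0..1}"
      by (intro fundamental_theorem_of_calculus) auto
    then have "integral {0..1} (\<lambda>t. frechet_derivative \<phi> (at (x0 + t *\<^sub>R (x - x0))) (x - x0)) = \<phi> x - \<phi> x0"
      by (simp add: integral_unique)
    moreover have "integral {0..1} (\<lambda>t. frechet_derivative \<phi> (at (x0 + t *\<^sub>R (x - x0))) (x - x0)) =
        integral {0..1} (\<lambda>t. \<Sum>b\<in>Basis. ((x - x0) \<bullet> b) *\<^sub>R frechet_derivative \<phi> (at (x0 + t *\<^sub>R (x - x0))) b)"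
      using mem smooth_on_differentiable[OF assms]
      by (intro integral_cong frechet_derivative_sum_Basis) blast
    moreover have "\<dots> = (\<Sum>b\<in>Basis. ((x - x0) \<bullet> b) * ?G b x)"
    proof -
      have cont: "continuous_on (ball x0 r) (\<lambda>x. frechet_derivative \<phi> (at x) b)" for b
        using smooth_on_frechet_derivative[OF assms, of b] unfolding smooth_on_def
        by (metis Ck_on.simps(1))
      have seg: "continuous_on {0..1} (\<lambda>t. x0 + t *\<^sub>R (x - x0))"
        by (intro continuous_intros)
      have int: "(\<lambda>t. frechet_derivative \<phi> (at (x0 + t *\<^sub>R (x - x0))) b) integrable_on {0..1}" for b
        by (rule integrable_continuous_real[OF continuous_on_compose2[OF cont seg]])
           (use mem in blast)
      show ?thesis
        by (rule trans[OF integral_sum[OF finite_Basis integrable_cmul[OF int]]])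
           (simp only: integral_cmul, simp only: real_scaleR_def)
    qed
    ultimately show ?thesis by linarith
  qed
  then show thesis
    by (rule that[of ?G, OF sm]) simp_all
qed

section \<open>Tangent vectors in charts\<close>

text \<open>A cutoff function is described by its effect instead of its support: it is 1 near
  \<open>p\<close> and turns each smooth function on the coordinate ball of radius \<open>r\<close>
  into a global smooth function by extension with 0. This makes sense without a topology on the
  points.\<close>

definition chart_bump ::
  "('p, 'e::euclidean_space) chart set \<Rightarrow> 'p set \<Rightarrow> ('p \<Rightarrow> 'e) \<Rightarrow> 'p \<Rightarrow> real \<Rightarrow> real \<Rightarrow> ('p \<Rightarrow> real) \<Rightarrow> bool"
  where
  "chart_bump A U c p r s \<psi> \<longleftrightarrow> 0 < s \<and> s \<le> r \<and> (\<forall>q\<in>U. c q \<in> ball (c p) s \<longrightarrow> \<psi> q = 1) \<and>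
     (\<forall>g. smooth_on (ball (c p) r) g \<longrightarrow>
        (\<lambda>q. if q \<in> U \<and> c q \<in> ball (c p) r then \<psi> q * g (c q) else 0) \<in> smooth_funs A)"

text \<open>Tangent vectors act on global functions, whereas the coordinates of a chart live on
  \<open>U\<close>; they are replaced by global smooth functions that coincide with them near
  \<open>p\<close>.\<close>

definition chart_coords ::
  "('p, 'e::euclidean_space) chart set \<Rightarrow> 'p set \<Rightarrow> ('p \<Rightarrow> 'e) \<Rightarrow> 'p \<Rightarrow> ('e \<Rightarrow> 'p \<Rightarrow> real) \<Rightarrow> real \<Rightarrow> bool"
  where
  "chart_coords A U c p h s \<longleftrightarrow> 0 < s \<and>
     (\<forall>b\<in>Basis. h b \<in> smooth_funs A \<and> (\<forall>q\<in>U. c q \<in> ball (c p) s \<longrightarrow> h b q = c q \<bullet> b))"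

locale open_charts =
  fixes A :: "('p, 'e::euclidean_space) chart set"
  assumes chart_inj: "(U, c) \<in> A \<Longrightarrow> inj_on c U"
    and chart_open: "(U, c) \<in> A \<Longrightarrow> open (c ` U)"
begin

abbreviation M :: "'p set" where "M \<equiv> \<Union>(U, c)\<in>A. U"

lemma smooth_funsI:
  "(\<And>U c. (U, c) \<in> A \<Longrightarrow> smooth_on (c ` U) (\<lambda>x. f (inv_into U c x))) \<Longrightarrow> f \<in> smooth_funs A"
  by (auto simp: smooth_funs_def o_def)

lemma smooth_funsD:
  "f \<in> smooth_funs A \<Longrightarrow> (U, c) \<in> A \<Longrightarrow> smooth_on (c ` U) (\<lambda>x. f (inv_into U c x))"
  by (auto simp: smooth_funs_def o_def)

lemma smooth_funs_localI:
  assumes "\<And>U c p. (U, c) \<in> A \<Longrightarrow> p \<in> U \<Longrightarrow>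
     \<exists>T. open T \<and> c p \<in> T \<and> smooth_on T (\<lambda>x. f (inv_into U c x))"
  shows "f \<in> smooth_funs A"
  by (rule smooth_funsI, rule smooth_on_local) (use assms in blast)

lemma smooth_funs_const: "(\<lambda>q. a) \<in> smooth_funs A"
  by (rule smooth_funsI) (rule smooth_on_const)

lemma smooth_funs_add:
  "f \<in> smooth_funs A \<Longrightarrow> g \<in> smooth_funs A \<Longrightarrow> (\<lambda>q. f q + g q) \<in> smooth_funs A"
  by (rule smooth_funsI) (intro smooth_on_add chart_open smooth_funsD)

lemma smooth_funs_mult:
  "f \<in> smooth_funs A \<Longrightarrow> g \<in> smooth_funs A \<Longrightarrow> (\<lambda>q. f q * g q) \<in> smooth_funs A"
  by (rule smooth_funsI) (intro smooth_on_mult chart_open smooth_funsD)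

lemma smooth_funs_scale: "f \<in> smooth_funs A \<Longrightarrow> (\<lambda>q. a * f q) \<in> smooth_funs A"
  by (intro smooth_funs_mult smooth_funs_const)

lemma smooth_funs_diff:
  "f \<in> smooth_funs A \<Longrightarrow> g \<in> smooth_funs A \<Longrightarrow> (\<lambda>q. f q - g q) \<in> smooth_funs A"
  using smooth_funs_add[of f "\<lambda>q. -1 * g q"] smooth_funs_scale[of g "-1"] by auto

lemma smooth_funs_sum:
  "(\<And>i. i \<in> I \<Longrightarrow> f i \<in> smooth_funs A) \<Longrightarrow> (\<lambda>q. \<Sum>i\<in>I. f i q) \<in> smooth_funs A"
  by (induction I rule: infinite_finite_induct) (auto intro: smooth_funs_const smooth_funs_add)

lemma smooth_funs_compose:
  fixes F :: "'p \<Rightarrow> 'f::euclidean_space"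
  assumes "\<And>b. b \<in> Basis \<Longrightarrow> (\<lambda>q. F q \<bullet> b) \<in> smooth_funs A" "smooth_on UNIV G"
  shows "(\<lambda>q. G (F q)) \<in> smooth_funs A"
proof (rule smooth_funsI)
  fix U c assume C: "(U, c) \<in> A"
  have "smooth_on (c ` U) (\<lambda>x. F (inv_into U c x))"
    by (rule smooth_on_componentwise[OF chart_open[OF C]]) (rule smooth_funsD[OF assms(1) C])
  then show "smooth_on (c ` U) (\<lambda>x. G (F (inv_into U c x)))"
    by (intro smooth_on_compose[OF chart_open[OF C] open_UNIV assms(2)]) auto
qed

lemma smooth_funs_cong:
  assumes "f \<in> smooth_funs A" "\<And>q. q \<in> M \<Longrightarrow> f q = g q"
  shows "g \<in> smooth_funs A"
proof (rule smooth_funsI)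
  fix U c assume C: "(U, c) \<in> A"
  have "f (inv_into U c x) = g (inv_into U c x)" if "x \<in> c ` U" for x
    using assms(2) C inv_into_into[OF that] by blast
  then show "smooth_on (c ` U) (\<lambda>x. g (inv_into U c x))"
    by (rule smooth_on_cong[OF chart_open[OF C], THEN iffD1]) (assumption, rule smooth_funsD[OF assms(1) C])
qed

end

text \<open>Cutoff functions are an assumption because the two instances obtain them differently: on
  the manifold from compactness in a Hausdorff space, on the slit bundle from those of the manifold
  and from Euclidean bumps.\<close>

locale charted = open_charts A
  for A :: "('p, 'e::euclidean_space) chart set" +
  assumes ex_bump: "(U, c) \<in> A \<Longrightarrow> p \<in> U \<Longrightarrow> 0 < r \<Longrightarrow> ball (c p) r \<subseteq> c ` U \<Longrightarrow>
      \<exists>s \<psi>. chart_bump A U c p r s \<psi>"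
begin

section \<open>Derivations of the algebra of smooth functions and their locality\<close>

lemma tangent_add:
  assumes "D \<in> tangent_space A p" "f \<in> smooth_funs A" "g \<in> smooth_funs A"
  shows "D (\<lambda>q. f q + g q) = D f + D g"
proof -
  have "D (f + g) = D f + D g" using assms unfolding tangent_space_def by blast
  then show ?thesis by (simp only: func_plus)
qed

lemma tangent_scale:
  "D \<in> tangent_space A p \<Longrightarrow> f \<in> smooth_funs A \<Longrightarrow> D (\<lambda>q. a * f q) = a * D f"
  unfolding tangent_space_def by blast

lemma tangent_mult:
  assumes "D \<in> tangent_space A p" "f \<in> smooth_funs A" "g \<in> smooth_funs A"
  shows "D (\<lambda>q. f q * g q) = D f * g p + f p * D g"
proof -
  have "D (f * g) = D f * g p + f p * D g" using assms unfolding tangent_space_def by blast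
  then show ?thesis by (simp only: func_times)
qed

lemma tangent_not_smooth: "D \<in> tangent_space A p \<Longrightarrow> f \<notin> smooth_funs A \<Longrightarrow> D f = 0"
  by (simp add: tangent_space_def)

lemma tangent_const: "D \<in> tangent_space A p \<Longrightarrow> D (\<lambda>q. a) = 0"
proof -
  assume D: "D \<in> tangent_space A p"
  have "D (\<lambda>q. 1) = 0"
    using tangent_mult[OF D smooth_funs_const smooth_funs_const, of 1 1] by simp
  then show ?thesis
    using tangent_scale[OF D smooth_funs_const, of a 1] by simp
qed

lemma tangent_diff:
  "D \<in> tangent_space A p \<Longrightarrow> f \<in> smooth_funs A \<Longrightarrow> g \<in> smooth_funs A \<Longrightarrow>
   D (\<lambda>q. f q - g q) = D f - D g"
  using tangent_add[of D p f "\<lambda>q. -1 * g q"] tangent_scale[of D p g "-1"] smooth_funs_scale[of g "-1"]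
  by auto

lemma tangent_sum:
  assumes "D \<in> tangent_space A p" "\<And>i. i \<in> I \<Longrightarrow> f i \<in> smooth_funs A"
  shows "D (\<lambda>q. \<Sum>i\<in>I. f i q) = (\<Sum>i\<in>I. D (f i))"
  using assms(2)
proof (induction I rule: infinite_finite_induct)
  case (insert i I)
  then show ?case
    using tangent_add[OF assms(1), of "f i" "\<lambda>q. \<Sum>i\<in>I. f i q"] smooth_funs_sum[of I f] by simp
qed (simp_all add: tangent_const[OF assms(1)])

text \<open>The indicator function of the complement of \<open>M\<close> is smooth, which is how the Leibniz rule
  makes tangent vectors blind to values off \<open>M\<close>.\<close>

lemma tangent_cong:
  assumes D: "D \<in> tangent_space A p" and p: "p \<in> M"
    and f: "f \<in> smooth_funs A" and eq: "\<And>q. q \<in> M \<Longrightarrow> f q = g q"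
  shows "D f = D g"
proof -
  have g: "g \<in> smooth_funs A" by (rule smooth_funs_cong[OF f eq])
  let ?\<chi> = "\<lambda>q. if q \<in> M then 0 else 1 :: real"
  have \<chi>: "?\<chi> \<in> smooth_funs A" by (rule smooth_funs_cong[OF smooth_funs_const]) simp
  have "(\<lambda>q. f q - g q) = (\<lambda>q. ?\<chi> q * (f q - g q))" using eq by auto
  then have "D (\<lambda>q. f q - g q) = D ?\<chi> * (f p - g p) + ?\<chi> p * D (\<lambda>q. f q - g q)"
    using tangent_mult[OF D \<chi> smooth_funs_diff[OF f g]] by simp
  then show ?thesis using p eq[OF p] tangent_diff[OF D f g] by simp
qed

lemma tangent_spaceI:
  assumes "\<And>f. f \<notin> smooth_funs A \<Longrightarrow> D f = 0"
    and "\<And>f g. f \<in> smooth_funs A \<Longrightarrow> g \<in> smooth_funs A \<Longrightarrow> D (\<lambda>q. f q + g q) = D f + D g"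
    and "\<And>f a. f \<in> smooth_funs A \<Longrightarrow> D (\<lambda>q. a * f q) = a * D f"
    and "\<And>f g. f \<in> smooth_funs A \<Longrightarrow> g \<in> smooth_funs A \<Longrightarrow> D (\<lambda>q. f q * g q) = D f * g p + f p * D g"
  shows "D \<in> tangent_space A p"
  unfolding tangent_space_def func_plus func_times using assms by blast

lemma zero_tangent: "0 \<in> tangent_space A p"
  by (rule tangent_spaceI) simp_all

lemma add_tangent:
  assumes "D \<in> tangent_space A p" "E \<in> tangent_space A p"
  shows "D + E \<in> tangent_space A p"
  by (rule tangent_spaceI)
     (simp_all add: assms[THEN tangent_not_smooth] assms[THEN tangent_add] assms[THEN tangent_scale]
       assms[THEN tangent_mult] distrib_left distrib_right)

lemma scale_tangent:
  assumes "D \<in> tangent_space A p"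
  shows "a *\<^sub>v D \<in> tangent_space A p"
  by (rule tangent_spaceI)
     (simp_all add: tangent_not_smooth[OF assms] tangent_add[OF assms] tangent_scale[OF assms]
       tangent_mult[OF assms] distrib_left)

lemma ex_ball:
  assumes "(U, c) \<in> A" "p \<in> U" "0 < s"
  obtains r where "0 < r" "r \<le> s" "ball (c p) r \<subseteq> c ` U"
proof -
  obtain e where "e > 0" "ball (c p) e \<subseteq> c ` U"
    using chart_open[OF assms(1)] assms(2) by (meson imageI openE)
  then show thesis using assms(3) by (intro that[of "min e s"]) auto
qed

text \<open>The cutoff is supported where \<open>f - g\<close> vanishes, so \<open>f - g\<close>
  equals its product with one minus the cutoff. Both factors are 0 at \<open>p\<close>, and the
  Leibniz rule gives 0.\<close>

lemma tangent_local:
  assumes D: "D \<in> tangent_space A p" and C: "(U, c) \<in> A" "p \<in> U" and s: "0 < s"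
    and f: "f \<in> smooth_funs A" and g: "g \<in> smooth_funs A"
    and eq: "\<And>q. q \<in> U \<Longrightarrow> c q \<in> ball (c p) s \<Longrightarrow> f q = g q"
  shows "D f = D g"
proof -
  obtain r where r: "0 < r" "r \<le> s" "ball (c p) r \<subseteq> c ` U" by (rule ex_ball[OF C s])
  obtain s' \<psi> where \<psi>: "chart_bump A U c p r s' \<psi>" using ex_bump[OF C r(1,3)] by blast
  let ?\<psi> = "\<lambda>q. if q \<in> U \<and> c q \<in> ball (c p) r then \<psi> q * 1 else 0"
  let ?h = "\<lambda>q. f q - g q" and ?k = "\<lambda>q. 1 - ?\<psi> q"
  have k: "?k \<in> smooth_funs A"
    using \<psi> smooth_on_const unfolding chart_bump_def
    by (intro smooth_funs_diff smooth_funs_const) blast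
  have p: "?\<psi> p = 1" using \<psi> C r(1) unfolding chart_bump_def by simp
  have "?h = (\<lambda>q. ?k q * ?h q)"
  proof
    fix q show "?h q = ?k q * ?h q" using eq[of q] r(2) by auto
  qed
  then have "D ?h = D ?k * ?h p + ?k p * D ?h"
    using tangent_mult[OF D k smooth_funs_diff[OF f g]] by simp
  moreover have "?h p = 0" using eq C s by simp
  ultimately show ?thesis by (simp only: p tangent_diff[OF D f g]) simp
qed

section \<open>Components of a tangent vector in a chart\<close>

lemma ex_chart_coords:
  assumes C: "(U, c) \<in> A" "p \<in> U"
  obtains h s where "chart_coords A U c p h s"
proof -
  obtain r where r: "0 < r" "ball (c p) r \<subseteq> c ` U" by (rule ex_ball[OF C, of 1]) auto
  obtain s \<psi> where \<psi>: "chart_bump A U c p r s \<psi>" using ex_bump[OF C r] by blast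
  let ?h = "\<lambda>b q. if q \<in> U \<and> c q \<in> ball (c p) r then \<psi> q * (c q \<bullet> b) else 0"
  have "chart_coords A U c p ?h s"
    using \<psi> smooth_on_linear[OF bounded_linear_inner_left]
    unfolding chart_coords_def chart_bump_def by auto
  then show thesis by (rule that)
qed

text \<open>One family \<open>h\<close> serves at all points near \<open>p\<close>, so that
  components computed with it can be compared from point to point.\<close>

lemma chart_coords_near:
  assumes "chart_coords A U c p h s" "q \<in> U" "c q \<in> ball (c p) s"
  obtains s' where "chart_coords A U c q h s'"
proof -
  obtain s' where "s' > 0" "ball (c q) s' \<subseteq> ball (c p) s"
    using assms(3) by (meson open_ball openE)
  then have "chart_coords A U c q h s'"
    using assms unfolding chart_coords_def by blast
  then show thesis by (rule that)
qed

text \<open>By Hadamard's lemma \<open>f\<close> is near \<open>p\<close> a constant plus a sum of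
  products of \<open>h b - c p \<bullet> b\<close>, which vanishes at \<open>p\<close>, with a
  smooth function. The derivation kills the constant, and the Leibniz rule leaves
  \<open>D (h b)\<close> times the value of the second factor at \<open>p\<close>, a partial
  derivative of \<open>f\<close>. So finitely many numbers determine \<open>D\<close>.\<close>

lemma tangent_eq_frechet:
  assumes D: "D \<in> tangent_space A p" and C: "(U, c) \<in> A" "p \<in> U"
    and h: "chart_coords A U c p h s" and f: "f \<in> smooth_funs A"
  shows "D f = frechet_derivative (f \<circ> inv_into U c) (at (c p)) (\<Sum>b\<in>Basis. D (h b) *\<^sub>R b)"
proof -
  have hs: "h b \<in> smooth_funs A"
    and hc: "q \<in> U \<Longrightarrow> c q \<in> ball (c p) s \<Longrightarrow> h b q = c q \<bullet> b" if "b \<in> Basis" for b q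
    using h that unfolding chart_coords_def by auto
  have s: "0 < s" using h unfolding chart_coords_def by auto
  obtain r where r: "0 < r" "r \<le> s" "ball (c p) r \<subseteq> c ` U" by (rule ex_ball[OF C s])
  let ?\<phi> = "\<lambda>x. f (inv_into U c x)"
  have sm: "smooth_on (ball (c p) r) ?\<phi>"
    by (rule smooth_on_subset[OF smooth_funsD[OF f C(1)] r(3)])
  obtain G where G: "\<And>b. smooth_on (ball (c p) r) (G b)"
    "\<And>x. x \<in> ball (c p) r \<Longrightarrow> ?\<phi> x = ?\<phi> (c p) + (\<Sum>b\<in>Basis. ((x - c p) \<bullet> b) * G b x)"
    "\<And>b. r > 0 \<Longrightarrow> G b (c p) = frechet_derivative ?\<phi> (at (c p)) b"
    using Hadamard_lemma[OF sm] by blast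
  obtain s' \<psi> where \<psi>: "chart_bump A U c p r s' \<psi>" using ex_bump[OF C r(1,3)] by blast
  let ?G = "\<lambda>b q. if q \<in> U \<and> c q \<in> ball (c p) r then \<psi> q * G b (c q) else 0"
  have Gs: "?G b \<in> smooth_funs A" for b using \<psi> G(1) unfolding chart_bump_def by blast
  have s': "0 < s'" "s' \<le> r" "\<And>q. q \<in> U \<Longrightarrow> c q \<in> ball (c p) s' \<Longrightarrow> \<psi> q = 1"
    using \<psi> unfolding chart_bump_def by auto
  let ?t = "\<lambda>b q. (h b q - c p \<bullet> b) * ?G b q"
  have ts: "?t b \<in> smooth_funs A" if "b \<in> Basis" for b
    by (intro smooth_funs_mult smooth_funs_diff smooth_funs_const Gs hs that)
  have iv: "inv_into U c (c q) = q" if "q \<in> U" for q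
    using chart_inj[OF C(1)] that by simp
  have "D f = D (\<lambda>q. f p + (\<Sum>b\<in>Basis. ?t b q))"
  proof (rule tangent_local[OF D C s'(1) f])
    show "(\<lambda>q. f p + (\<Sum>b\<in>Basis. ?t b q)) \<in> smooth_funs A"
      by (intro smooth_funs_add smooth_funs_const smooth_funs_sum ts)
    fix q assume q: "q \<in> U" "c q \<in> ball (c p) s'"
    then have qr: "c q \<in> ball (c p) r" "c q \<in> ball (c p) s" using s'(2) r(2) by auto
    show "f q = f p + (\<Sum>b\<in>Basis. ?t b q)"
      using G(2)[OF qr(1)] q qr hc[OF _ q(1) qr(2)] s'(3)[OF q] iv C(2)
      by (simp add: inner_diff_left)
  qed
  also have "\<dots> = (\<Sum>b\<in>Basis. D (?t b))"
    using ts by (simp add: tangent_add[OF D] tangent_sum[OF D] tangent_const[OF D]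
        smooth_funs_const smooth_funs_sum)
  also have "\<dots> = (\<Sum>b\<in>Basis. D (h b) * frechet_derivative ?\<phi> (at (c p)) b)"
  proof (rule sum.cong)
    fix b :: 'e assume b: "b \<in> Basis"
    have "D (?t b) = D (\<lambda>q. h b q - c p \<bullet> b) * ?G b p + (h b p - c p \<bullet> b) * D (?G b)"
      by (rule tangent_mult[OF D]) (intro smooth_funs_diff smooth_funs_const Gs hs b)+
    also have "D (\<lambda>q. h b q - c p \<bullet> b) = D (h b)"
      by (simp add: tangent_diff[OF D hs[OF b] smooth_funs_const] tangent_const[OF D])
    also have "h b p - c p \<bullet> b = 0" using hc[OF b C(2)] s by simp
    also have "?G b p = frechet_derivative ?\<phi> (at (c p)) b"
      using G(3)[OF r(1)] C(2) r(1) s' by simp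
    finally show "D (?t b) = D (h b) * frechet_derivative ?\<phi> (at (c p)) b"
      by (simp only: mult_zero_left add_0_right)
  qed (rule refl)
  also have "\<dots> = frechet_derivative ?\<phi> (at (c p)) (\<Sum>b\<in>Basis. D (h b) *\<^sub>R b)"
  proof -
    have "linear (frechet_derivative ?\<phi> (at (c p)))"
      using smooth_on_differentiable[OF sm, of "c p"] r(1) by (simp add: linear_frechet_derivative)
    then show ?thesis by (simp add: linear_sum linear_scale)
  qed
  finally show ?thesis by (simp add: o_def)
qed

lemma smooth_funs_has_derivative:
  assumes "f \<in> smooth_funs A" "(U, c) \<in> A" "x \<in> c ` U"
  shows "((f \<circ> inv_into U c) has_derivative frechet_derivative (f \<circ> inv_into U c) (at x)) (at x)"
  using smooth_on_has_derivative[OF smooth_funsD[OF assms(1,2)] assms(3)] by (simp add: o_def)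

lemma linear_frechet_chart:
  assumes "f \<in> smooth_funs A" "(U, c) \<in> A" "p \<in> U"
  shows "linear (frechet_derivative (f \<circ> inv_into U c) (at (c p)))"
  using has_derivative_linear[OF smooth_funs_has_derivative[OF assms(1,2) imageI[OF assms(3)]]] .

lemma chart_vector_add:
  assumes "(U, c) \<in> A" "p \<in> U"
  shows "chart_vector A (U, c) p (v + w) = chart_vector A (U, c) p v + chart_vector A (U, c) p w"
  using linear_add[OF linear_frechet_chart[OF _ assms]]
  by (simp add: chart_vector_def fun_eq_iff)

lemma chart_vector_scale:
  assumes "(U, c) \<in> A" "p \<in> U"
  shows "chart_vector A (U, c) p (a *\<^sub>R v) = a *\<^sub>v chart_vector A (U, c) p v"
  using linear_scale[OF linear_frechet_chart[OF _ assms]]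
  by (simp add: chart_vector_def fun_eq_iff)

lemma chart_vector_tangent:
  assumes C: "(U, c) \<in> A" "p \<in> U"
  shows "chart_vector A (U, c) p w \<in> tangent_space A p"
proof -
  let ?D = "chart_vector A (U, c) p w"
  have iv: "inv_into U c (c p) = p" using chart_inj[OF C(1)] C(2) by simp
  note der = smooth_funs_has_derivative[OF _ C(1) imageI[OF C(2)], unfolded o_def]
  have eq: "?D f = d w" if f: "f \<in> smooth_funs A"
    and d: "((\<lambda>x. f (inv_into U c x)) has_derivative d) (at (c p))" for f d
    using frechet_derivative_at[OF d] f by (simp add: chart_vector_def o_def)
  have "?D (f + g) = ?D f + ?D g" if "f \<in> smooth_funs A" "g \<in> smooth_funs A" for f g
    using eq[OF smooth_funs_add[OF that] has_derivative_add[OF der[OF that(1)] der[OF that(2)]]]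
      eq[OF that(1) der[OF that(1)]] eq[OF that(2) der[OF that(2)]]
    by (simp add: func_plus)
  moreover have "?D (\<lambda>x. a * f x) = a * ?D f" if "f \<in> smooth_funs A" for f a
    using eq[OF smooth_funs_scale[OF that] has_derivative_mult_right[OF der[OF that]]]
      eq[OF that der[OF that]] by simp
  moreover have "?D (f * g) = ?D f * g p + f p * ?D g"
    if "f \<in> smooth_funs A" "g \<in> smooth_funs A" for f g
    using eq[OF smooth_funs_mult[OF that] has_derivative_mult[OF der[OF that(1)] der[OF that(2)]]]
      eq[OF that(1) der[OF that(1)]] eq[OF that(2) der[OF that(2)]]
    by (simp add: func_times iv)
  ultimately show ?thesis
    unfolding tangent_space_def by (simp add: chart_vector_def)
qed

lemma chart_vector_coord:
  assumes C: "(U, c) \<in> A" "p \<in> U" and h: "chart_coords A U c p h s" and b: "b \<in> Basis"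
  shows "chart_vector A (U, c) p w (h b) = w \<bullet> b"
proof -
  have s: "0 < s" and hs: "h b \<in> smooth_funs A"
    and hc: "\<And>q. q \<in> U \<Longrightarrow> c q \<in> ball (c p) s \<Longrightarrow> h b q = c q \<bullet> b"
    using h b unfolding chart_coords_def by auto
  have "((h b \<circ> inv_into U c) has_derivative (\<lambda>w. w \<bullet> b)) (at (c p))"
  proof (rule has_derivative_transform_within_open[where s = "c ` U \<inter> ball (c p) s"])
    show "((\<lambda>x. x \<bullet> b) has_derivative (\<lambda>w. w \<bullet> b)) (at (c p))"
      by (auto intro!: derivative_eq_intros)
    show "open (c ` U \<inter> ball (c p) s)" using chart_open[OF C(1)] by blast
    show "c p \<in> c ` U \<inter> ball (c p) s" using C s by simp
    show "x \<bullet> b = (h b \<circ> inv_into U c) x" if "x \<in> c ` U \<inter> ball (c p) s" for x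
      using that chart_inj[OF C(1)] hc by auto
  qed
  from frechet_derivative_at[OF this] show ?thesis
    using hs by (simp add: chart_vector_def) metis
qed

lemma tangent_eq_chart_vector:
  assumes "D \<in> tangent_space A p" "(U, c) \<in> A" "p \<in> U" "chart_coords A U c p h s"
  shows "D = chart_vector A (U, c) p (\<Sum>b\<in>Basis. D (h b) *\<^sub>R b)"
proof
  fix f
  show "D f = chart_vector A (U, c) p (\<Sum>b\<in>Basis. D (h b) *\<^sub>R b) f"
    using tangent_eq_frechet[OF assms, of f] tangent_not_smooth[OF assms(1), of f]
    by (simp add: chart_vector_def)
qed

lemma chart_vector_eq_iff:
  assumes "(U, c) \<in> A" "p \<in> U"
  shows "chart_vector A (U, c) p v = chart_vector A (U, c) p w \<longleftrightarrow> v = w"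
proof -
  obtain h s where "chart_coords A U c p h s" by (rule ex_chart_coords[OF assms])
  then show ?thesis
    using chart_vector_coord[OF assms] by (metis euclidean_eqI)
qed

lemma chart_vector_zero_iff:
  assumes "(U, c) \<in> A" "p \<in> U"
  shows "chart_vector A (U, c) p w = 0 \<longleftrightarrow> w = 0"
proof -
  have "chart_vector A (U, c) p 0 = 0"
    using chart_vector_scale[OF assms, of 0 0] by (simp add: fun_eq_iff)
  then show ?thesis using chart_vector_eq_iff[OF assms, of w 0] by simp
qed

lemma tangent_eqI:
  assumes "D \<in> tangent_space A p" "E \<in> tangent_space A p" "(U, c) \<in> A" "p \<in> U"
    and "chart_coords A U c p h s" "\<And>b. b \<in> Basis \<Longrightarrow> D (h b) = E (h b)"
  shows "D = E"
proof -
  have "(\<Sum>b\<in>Basis. D (h b) *\<^sub>R b) = (\<Sum>b\<in>Basis. E (h b) *\<^sub>R b)"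
    by (rule sum.cong[OF refl]) (simp add: assms(6))
  then show ?thesis
    using tangent_eq_chart_vector[OF assms(1,3,4,5)] tangent_eq_chart_vector[OF assms(2,3,4,5)] by argo
qed

lemma chart_vector_surj:
  assumes "D \<in> tangent_space A p" "(U, c) \<in> A" "p \<in> U"
  obtains w where "D = chart_vector A (U, c) p w"
proof -
  obtain h s where "chart_coords A U c p h s" by (rule ex_chart_coords[OF assms(2,3)])
  from tangent_eq_chart_vector[OF assms this] show thesis by (rule that)
qed

section \<open>Vector fields and their brackets\<close>

lemma ex_local_frame:
  assumes C: "(U, c) \<in> A" "p \<in> U"
  obtains V s where "0 < s" "\<And>w. V w \<in> vector_fields A M"
    "\<And>w q. q \<in> U \<Longrightarrow> c q \<in> ball (c p) s \<Longrightarrow> V w q = chart_vector A (U, c) q w"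
proof -
  obtain r where r: "0 < r" "ball (c p) r \<subseteq> c ` U" by (rule ex_ball[OF C, of 1]) auto
  obtain s \<psi> where \<psi>: "chart_bump A U c p r s \<psi>" using ex_bump[OF C r] by blast
  \<comment> \<open>The coordinate fields are cut off to become global, because a connection is only
    required to be smooth along global vector fields.\<close>
  let ?V = "\<lambda>w q. if q \<in> U \<and> c q \<in> ball (c p) r then \<psi> q *\<^sub>v chart_vector A (U, c) q w else 0"
  have "?V w q \<in> tangent_space A q" for w q
    by (simp add: zero_tangent scale_tangent chart_vector_tangent[OF C(1)])
  moreover have "(\<lambda>q. ?V w q f) \<in> smooth_funs A" if f: "f \<in> smooth_funs A" for w f
  proof -
    have "smooth_on (ball (c p) r) (\<lambda>x. frechet_derivative (f \<circ> inv_into U c) (at x) w)"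
      by (rule smooth_on_frechet_derivative, rule smooth_on_subset[OF _ r(2)])
         (use smooth_funsD[OF f C(1)] in \<open>simp add: o_def\<close>)
    then have "(\<lambda>q. if q \<in> U \<and> c q \<in> ball (c p) r
        then \<psi> q * frechet_derivative (f \<circ> inv_into U c) (at (c q)) w else 0) \<in> smooth_funs A"
      using \<psi> unfolding chart_bump_def by blast
    also have "(\<lambda>q. if q \<in> U \<and> c q \<in> ball (c p) r
        then \<psi> q * frechet_derivative (f \<circ> inv_into U c) (at (c q)) w else 0) = (\<lambda>q. ?V w q f)"
      using f by (auto simp: chart_vector_def)
    finally show ?thesis .
  qed
  ultimately have "?V w \<in> vector_fields A M" for w
    unfolding vector_fields_def by blast
  moreover have "?V w q = chart_vector A (U, c) q w" if "q \<in> U" "c q \<in> ball (c p) s" for w q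
    using \<psi> that unfolding chart_bump_def by auto
  moreover have "0 < s" using \<psi> unfolding chart_bump_def by simp
  ultimately show thesis using that[of s ?V] by blast
qed

text \<open>The products of first derivatives in \<open>mult\<close> are symmetric in the two fields
  and cancel in the commutator. The rules for the inner field hold only at points of
  \<open>M\<close>, so \<open>tangent_cong\<close> is what carries them under the outer
  derivation.\<close>

lemma lie_bracket_tangent:
  assumes X: "X \<in> vector_fields A M" and Y: "Y \<in> vector_fields A M" and p: "p \<in> M"
  shows "lie_bracket A X Y p \<in> tangent_space A p"
proof -
  let ?B = "\<lambda>f. X p (\<lambda>q. Y q f) - Y p (\<lambda>q. X q f)"
  have add: "Z p (\<lambda>q. W q (\<lambda>x. f x + g x)) = Z p (\<lambda>q. W q f) + Z p (\<lambda>q. W q g)"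
    if "f \<in> smooth_funs A" "g \<in> smooth_funs A" "Z \<in> vector_fields A M" "W \<in> vector_fields A M" for f g Z W
  proof -
    have W: "\<And>q. q \<in> M \<Longrightarrow> W q \<in> tangent_space A q" "\<And>f. f \<in> smooth_funs A \<Longrightarrow> (\<lambda>q. W q f) \<in> smooth_funs A"
      and Z: "Z p \<in> tangent_space A p"
      using that p unfolding vector_fields_def by auto
    have "Z p (\<lambda>q. W q (\<lambda>x. f x + g x)) = Z p (\<lambda>q. W q f + W q g)"
      using W(1) that(1,2) by (intro tangent_cong[OF Z p] W(2) smooth_funs_add tangent_add)
    then show ?thesis using tangent_add[OF Z] W(2) that by simp
  qed
  have scale: "Z p (\<lambda>q. W q (\<lambda>x. a * f x)) = a * Z p (\<lambda>q. W q f)"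
    if "f \<in> smooth_funs A" "Z \<in> vector_fields A M" "W \<in> vector_fields A M" for f a Z W
  proof -
    have W: "\<And>q. q \<in> M \<Longrightarrow> W q \<in> tangent_space A q" "\<And>f. f \<in> smooth_funs A \<Longrightarrow> (\<lambda>q. W q f) \<in> smooth_funs A"
      and Z: "Z p \<in> tangent_space A p"
      using that p unfolding vector_fields_def by auto
    have "Z p (\<lambda>q. W q (\<lambda>x. a * f x)) = Z p (\<lambda>q. a * W q f)"
      using W(1) that(1) by (intro tangent_cong[OF Z p] W(2) smooth_funs_scale tangent_scale)
    then show ?thesis using tangent_scale[OF Z] W(2) that by simp
  qed
  have mult: "Z p (\<lambda>q. W q (\<lambda>x. f x * g x)) =
      Z p (\<lambda>q. W q f) * g p + W p f * Z p g + Z p f * W p g + f p * Z p (\<lambda>q. W q g)"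
    if "f \<in> smooth_funs A" "g \<in> smooth_funs A" "Z \<in> vector_fields A M" "W \<in> vector_fields A M" for f g Z W
  proof -
    have W: "\<And>q. q \<in> M \<Longrightarrow> W q \<in> tangent_space A q" "\<And>f. f \<in> smooth_funs A \<Longrightarrow> (\<lambda>q. W q f) \<in> smooth_funs A"
      and Z: "Z p \<in> tangent_space A p"
      using that p unfolding vector_fields_def by auto
    have "Z p (\<lambda>q. W q (\<lambda>x. f x * g x)) = Z p (\<lambda>q. W q f * g q + f q * W q g)"
      using W(1) that(1,2) by (intro tangent_cong[OF Z p] W(2) smooth_funs_mult tangent_mult)
    then show ?thesis
      using W(2) that by (simp add: tangent_add[OF Z] tangent_mult[OF Z] smooth_funs_mult)
  qed
  have eq: "lie_bracket A X Y p f = ?B f" if "f \<in> smooth_funs A" for f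
    using that by (simp add: lie_bracket_def)
  show ?thesis
    unfolding tangent_space_def
  proof (intro CollectI conjI ballI allI impI)
    fix f g a
    assume f: "f \<in> smooth_funs A"
    show "lie_bracket A X Y p (\<lambda>x. a * f x) = a * lie_bracket A X Y p f"
      unfolding eq[OF f] eq[OF smooth_funs_scale[OF f]] scale[OF f X Y] scale[OF f Y X]
      by (rule right_diff_distrib[symmetric])
    assume g: "g \<in> smooth_funs A"
    show "lie_bracket A X Y p (f + g) = lie_bracket A X Y p f + lie_bracket A X Y p g"
      unfolding func_plus eq[OF f] eq[OF g] eq[OF smooth_funs_add[OF f g]] add[OF f g X Y] add[OF f g Y X]
      by simp
    show "lie_bracket A X Y p (f * g) = lie_bracket A X Y p f * g p + f p * lie_bracket A X Y p g"
      unfolding func_times eq[OF f] eq[OF g] eq[OF smooth_funs_mult[OF f g]] mult[OF f g X Y] mult[OF f g Y X]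
      by (simp add: algebra_simps)
  qed (simp add: lie_bracket_def)
qed

end

section \<open>The slit tangent bundle as a manifold\<close>

locale smooth_manifold =
  fixes A :: "('a::t2_space, 'e::euclidean_space) chart set"
  assumes atlas: "smooth_atlas A"
begin

lemma atlas_cover: "(\<Union>(U, c)\<in>A. U) = UNIV"
  using atlas unfolding smooth_atlas_def by blast

lemma atlas_homeomorphism: "(U, c) \<in> A \<Longrightarrow> homeomorphism U (c ` U) c (inv_into U c)"
  and atlas_open: "(U, c) \<in> A \<Longrightarrow> open U"
  and atlas_open_image: "(U, c) \<in> A \<Longrightarrow> open (c ` U)"
proof -
  have "\<forall>C\<in>A. open (fst C) \<and> open (snd C ` fst C) \<and>
      homeomorphism (fst C) (snd C ` fst C) (snd C) (inv_into (fst C) (snd C))"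
    using atlas unfolding smooth_atlas_def by (simp add: case_prod_unfold)
  from bspec[OF this, of "(U, c)"]
  show "(U, c) \<in> A \<Longrightarrow> homeomorphism U (c ` U) c (inv_into U c)"
    and "(U, c) \<in> A \<Longrightarrow> open U" and "(U, c) \<in> A \<Longrightarrow> open (c ` U)"
    by simp_all
qed

lemma atlas_transition:
  assumes "(U, c) \<in> A" "(V, d) \<in> A"
  shows "smooth_on (c ` (U \<inter> V)) (\<lambda>x. d (inv_into U c x))"
proof -
  have "\<forall>C\<in>A. \<forall>D\<in>A. smooth_on (snd C ` (fst C \<inter> fst D)) (snd D \<circ> inv_into (fst C) (snd C))"
    using atlas unfolding smooth_atlas_def by (simp add: case_prod_unfold)
  from bspec[OF bspec[OF this assms(1)] assms(2)] show ?thesis by (simp add: o_def)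
qed

lemma atlas_open_map:
  assumes "(U, c) \<in> A" "open T"
  shows "open (c ` (U \<inter> T))"
proof -
  have "openin (top_of_set (c ` U)) (c ` (U \<inter> T))"
    by (rule homeomorphism_imp_open_map[OF atlas_homeomorphism[OF assms(1)]])
       (use assms(2) in \<open>auto simp: openin_open\<close>)
  then show ?thesis using atlas_open_image[OF assms(1)] openin_open_trans by blast
qed

lemma atlas_inj: "(U, c) \<in> A \<Longrightarrow> inj_on c U"
  by (rule inj_on_inverseI, rule homeomorphism_apply1[OF atlas_homeomorphism])

lemma ex_chart: obtains U c where "(U, c) \<in> A" "p \<in> U"
proof -
  have "p \<in> (\<Union>(U, c)\<in>A. U)" unfolding atlas_cover by (rule UNIV_I)
  then show thesis using that by (auto simp: split_paired_Ex)
qed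

sublocale open_charts A
  by unfold_locales (rule atlas_inj, assumption, rule atlas_open_image)

text \<open>The cutoff is a Euclidean bump composed with \<open>c\<close>. Seen in a second chart,
  the extended function is smooth near points of \<open>U\<close> by the transition map. Near all
  other points it is 0, because it vanishes off the compact set \<open>K\<close>, which is closed in
  a Hausdorff space and contained in \<open>U\<close>.\<close>

sublocale charted A
proof unfold_locales
  fix U c p and r :: real
  assume C: "(U, c) \<in> A" "p \<in> U" and r: "0 < r" and sub: "ball (c p) r \<subseteq> c ` U"
  obtain \<psi> :: "'e \<Rightarrow> real" where \<psi>: "smooth_on UNIV \<psi>"
    "\<And>x. x \<in> ball (c p) (r / 3) \<Longrightarrow> \<psi> x = 1" "\<And>x. x \<notin> cball (c p) (r / 2) \<Longrightarrow> \<psi> x = 0"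
    using smooth_bump_exists[OF r] by blast
  define K where "K = inv_into U c ` cball (c p) (r / 2)"
  have sub2: "cball (c p) (r / 2) \<subseteq> c ` U"
    by (rule order_trans[OF _ sub]) (use r in auto)
  have "compact K"
    unfolding K_def
    by (intro compact_continuous_image compact_cball
        continuous_on_subset[OF homeomorphism_cont2[OF atlas_homeomorphism[OF C(1)]] sub2])
  then have K: "closed K" by (rule compact_imp_closed)
  have "inv_into U c x \<in> U" if "x \<in> cball (c p) (r / 2)" for x
    by (rule inv_into_into) (use sub2 that in blast)
  then have KU: "K \<subseteq> U" unfolding K_def by blast
  have "(\<lambda>q. if q \<in> U \<and> c q \<in> ball (c p) r then \<psi> (c q) * g (c q) else 0) \<in> smooth_funs A"
    if g: "smooth_on (ball (c p) r) g" for g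
  proof (rule smooth_funs_localI)
    fix V d q assume D: "(V, d) \<in> A" "q \<in> V"
    let ?F = "\<lambda>q. if q \<in> U \<and> c q \<in> ball (c p) r then \<psi> (c q) * g (c q) else 0"
    let ?G = "\<lambda>x. if x \<in> ball (c p) r then \<psi> x * g x else 0"
    have G: "smooth_on UNIV ?G"
      by (rule smooth_on_bump_extension[where \<delta> = "r / 2", OF \<psi>(1)])
         (fact \<psi>(3), use r in simp, fact g)
    have iv: "inv_into V d (d y) = y" if "y \<in> V" for y
      using atlas_inj[OF D(1)] that by simp
    show "\<exists>T. open T \<and> d q \<in> T \<and> smooth_on T (\<lambda>x. ?F (inv_into V d x))"
    proof (cases "q \<in> U")
      case True
      let ?T = "d ` (V \<inter> U)"
      have op: "open ?T" by (rule atlas_open_map[OF D(1) atlas_open[OF C(1)]])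
      have "smooth_on ?T (\<lambda>x. ?G (c (inv_into V d x)))"
        by (rule smooth_on_compose[OF op open_UNIV G atlas_transition[OF D(1) C(1)]]) simp
      then have "smooth_on ?T (\<lambda>x. ?F (inv_into V d x))"
        by (rule smooth_on_cong[OF op, THEN iffD1, rotated]) (auto simp: iv)
      then show ?thesis using op True D(2) by blast
    next
      case False
      let ?T = "d ` (V \<inter> - K)"
      have op: "open ?T" by (rule atlas_open_map[OF D(1)]) (use K in blast)
      have "?F y = 0" if "y \<notin> K" for y
      proof -
        have "\<psi> (c y) = 0" if "y \<in> U"
        proof (rule \<psi>(3), rule notI)
          assume "c y \<in> cball (c p) (r / 2)"
          then have "inv_into U c (c y) \<in> K" unfolding K_def by blast
          then show False using \<open>y \<notin> K\<close> atlas_inj[OF C(1)] that by simp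
        qed
        then show ?thesis by simp
      qed
      then have "0 = ?F (inv_into V d x)" if "x \<in> ?T" for x using that iv by force
      then have "smooth_on ?T (\<lambda>x. ?F (inv_into V d x))"
        by (rule smooth_on_cong[OF op, THEN iffD1]) (assumption, rule smooth_on_const)
      moreover have "q \<in> - K" using KU False by blast
      ultimately show ?thesis using op D(2) by blast
    qed
  qed
  then have "chart_bump A U c p r (r / 3) (\<lambda>q. \<psi> (c q))"
    unfolding chart_bump_def using r \<psi>(2) by auto
  then show "\<exists>s \<psi>. chart_bump A U c p r s \<psi>" by blast
qed

section \<open>Standard charts and smooth functions of the slit bundle\<close>

abbreviation slit_dom :: "'a set \<Rightarrow> 'a tb set" where
  "slit_dom U \<equiv> {u \<in> slit_bundle A. fst u \<in> U}"

definition slit_map :: "'a set \<Rightarrow> ('a \<Rightarrow> 'e) \<Rightarrow> 'a tb \<Rightarrow> 'e \<times> 'e" where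
  "slit_map U c = (\<lambda>u. (c (fst u), THE w. snd u = chart_vector A (U, c) (fst u) w))"

lemma slit_chart_eq: "slit_chart A (U, c) = (slit_dom U, slit_map U c)"
  by (simp add: slit_chart_def slit_map_def)

lemma slit_atlas_iff:
  "(U', c') \<in> slit_atlas A \<longleftrightarrow> (\<exists>U c. (U, c) \<in> A \<and> U' = slit_dom U \<and> c' = slit_map U c)"
  unfolding slit_atlas_def by (simp add: image_iff Bex_def slit_chart_eq)

lemma slit_atlas_mem: "(U, c) \<in> A \<Longrightarrow> (slit_dom U, slit_map U c) \<in> slit_atlas A"
  unfolding slit_atlas_iff by blast

lemma slit_dom_chart_vector:
  assumes "(U, c) \<in> A" "p \<in> U"
  shows "(p, chart_vector A (U, c) p w) \<in> slit_dom U \<longleftrightarrow> w \<noteq> 0"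
  using chart_vector_tangent[OF assms] chart_vector_zero_iff[OF assms] assms(2)
  by (simp add: slit_bundle_def)

lemma slit_dom_cases:
  assumes "(U, c) \<in> A" "u \<in> slit_dom U"
  obtains p w where "p \<in> U" "w \<noteq> 0" "u = (p, chart_vector A (U, c) p w)"
proof -
  obtain p v where u: "u = (p, v)" by force
  have v: "v \<in> tangent_space A p" "v \<noteq> 0" "p \<in> U" using assms(2) u by (auto simp: slit_bundle_def)
  obtain w where w: "v = chart_vector A (U, c) p w" using chart_vector_surj[OF v(1) assms(1) v(3)] by blast
  show thesis using that[OF v(3) _ u[unfolded w]] v(2) w chart_vector_zero_iff[OF assms(1) v(3)] by blast
qed

lemma slit_map_chart_vector:
  assumes "(U, c) \<in> A" "p \<in> U"
  shows "slit_map U c (p, chart_vector A (U, c) p w) = (c p, w)"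
  by (simp add: slit_map_def chart_vector_eq_iff[OF assms])

lemma slit_map_image:
  assumes C: "(U, c) \<in> A"
  shows "slit_map U c ` slit_dom U = c ` U \<times> (- {0})"
proof
  show "slit_map U c ` slit_dom U \<subseteq> c ` U \<times> (- {0})"
  proof
    fix z assume "z \<in> slit_map U c ` slit_dom U"
    then obtain u where u: "u \<in> slit_dom U" "z = slit_map U c u" by blast
    obtain p w where pw: "p \<in> U" "w \<noteq> 0" "u = (p, chart_vector A (U, c) p w)"
      by (rule slit_dom_cases[OF C u(1)])
    show "z \<in> c ` U \<times> (- {0})"
      using u(2) slit_map_chart_vector[OF C pw(1), of w] pw by simp
  qed
  show "c ` U \<times> (- {0}) \<subseteq> slit_map U c ` slit_dom U"
  proof
    fix z assume "z \<in> c ` U \<times> (- {0 :: 'e})"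
    then obtain p w where pw: "p \<in> U" "w \<noteq> 0" "z = (c p, w)" by auto
    then have "z = slit_map U c (p, chart_vector A (U, c) p w)"
      using slit_map_chart_vector[OF C pw(1), of w] by simp
    moreover have "(p, chart_vector A (U, c) p w) \<in> slit_dom U"
      using slit_dom_chart_vector[OF C pw(1)] pw(2) by blast
    ultimately show "z \<in> slit_map U c ` slit_dom U" by blast
  qed
qed

lemma slit_map_inj:
  assumes C: "(U, c) \<in> A"
  shows "inj_on (slit_map U c) (slit_dom U)"
proof (rule inj_onI)
  fix u v assume u: "u \<in> slit_dom U" and v: "v \<in> slit_dom U" and eq: "slit_map U c u = slit_map U c v"
  obtain p w where pw: "p \<in> U" "w \<noteq> 0" "u = (p, chart_vector A (U, c) p w)"
    by (rule slit_dom_cases[OF C u])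
  obtain q y where qy: "q \<in> U" "y \<noteq> 0" "v = (q, chart_vector A (U, c) q y)"
    by (rule slit_dom_cases[OF C v])
  have "(c p, w) = (c q, y)"
    using eq unfolding pw(3) qy(3) slit_map_chart_vector[OF C pw(1)] slit_map_chart_vector[OF C qy(1)] .
  then show "u = v" using atlas_inj[OF C] pw qy by (auto dest: inj_onD)
qed

lemma inv_slit_map:
  assumes C: "(U, c) \<in> A" and z: "x \<in> c ` U" "w \<noteq> 0"
  shows "inv_into (slit_dom U) (slit_map U c) (x, w) =
    (inv_into U c x, chart_vector A (U, c) (inv_into U c x) w)"
proof -
  have p: "inv_into U c x \<in> U" "c (inv_into U c x) = x"
    using z(1) by (auto intro: inv_into_into f_inv_into_f)
  have "(inv_into U c x, chart_vector A (U, c) (inv_into U c x) w) \<in> slit_dom U"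
    using slit_dom_chart_vector[OF C p(1)] z(2) by blast
  from inv_into_f_f[OF slit_map_inj[OF C] this]
  show ?thesis unfolding slit_map_chart_vector[OF C p(1)] p(2) .
qed

sublocale TM: open_charts "slit_atlas A"
proof
  fix U' c' assume "(U', c') \<in> slit_atlas A"
  then obtain U c where C: "(U, c) \<in> A" and eq: "U' = slit_dom U" "c' = slit_map U c"
    unfolding slit_atlas_iff by blast
  show "inj_on c' U'" unfolding eq by (rule slit_map_inj[OF C])
  have "open (c ` U \<times> (- {0 :: 'e}))" using atlas_open_image[OF C] by (intro open_Times) auto
  then show "open (c' ` U')" unfolding eq slit_map_image[OF C] .
qed

lemma slit_cover: "TM.M = slit_bundle A"
proof
  show "TM.M \<subseteq> slit_bundle A" unfolding slit_atlas_def by (auto simp: slit_chart_def)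
  show "slit_bundle A \<subseteq> TM.M"
  proof
    fix u assume u: "u \<in> slit_bundle A"
    obtain U c where C: "(U, c) \<in> A" "fst u \<in> U" by (rule ex_chart)
    then show "u \<in> TM.M" using slit_atlas_mem[OF C(1)] u by blast
  qed
qed

text \<open>Smoothness is tested in the coordinates \<open>(x, w)\<close> of base point and
  components, which eliminates the \<open>inv_into\<close> of a bundle chart once and for
  all.\<close>

lemma slit_smooth_funsI:
  assumes "\<And>U c. (U, c) \<in> A \<Longrightarrow> \<exists>F. smooth_on (c ` U \<times> (- {0 :: 'e})) F \<and>
    (\<forall>x w. x \<in> c ` U \<longrightarrow> w \<noteq> 0 \<longrightarrow>
      f (inv_into U c x, chart_vector A (U, c) (inv_into U c x) w) = F (x, w))"
  shows "f \<in> smooth_funs (slit_atlas A)"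
proof (rule TM.smooth_funsI)
  fix U' c' assume C': "(U', c') \<in> slit_atlas A"
  then obtain U c where C: "(U, c) \<in> A" and eq: "U' = slit_dom U" "c' = slit_map U c"
    unfolding slit_atlas_iff by blast
  obtain F where F: "smooth_on (c ` U \<times> (- {0 :: 'e})) F"
    "\<And>x w. x \<in> c ` U \<Longrightarrow> w \<noteq> 0 \<Longrightarrow>
      f (inv_into U c x, chart_vector A (U, c) (inv_into U c x) w) = F (x, w)"
    using assms[OF C] by blast
  have im: "c' ` U' = c ` U \<times> (- {0 :: 'e})" unfolding eq by (rule slit_map_image[OF C])
  have "F z = f (inv_into U' c' z)" if "z \<in> c' ` U'" for z
  proof -
    obtain x w where z: "z = (x, w)" "x \<in> c ` U" "w \<noteq> 0" using \<open>z \<in> c' ` U'\<close> unfolding im by blast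
    show ?thesis using F(2)[OF z(2,3)] unfolding z(1) eq inv_slit_map[OF C z(2,3)] by (rule sym)
  qed
  then show "smooth_on (c' ` U') (\<lambda>z. f (inv_into U' c' z))"
    by (rule smooth_on_cong[OF TM.chart_open[OF C'], THEN iffD1]) (assumption, unfold im, rule F(1))
qed

lemma slit_open: "(U, c) \<in> A \<Longrightarrow> open (c ` U \<times> (- {0 :: 'e}))"
  using atlas_open_image by (intro open_Times) auto

lemma smooth_funs_fst:
  assumes h: "h \<in> smooth_funs A"
  shows "(\<lambda>u. h (fst u)) \<in> smooth_funs (slit_atlas A)"
proof (rule slit_smooth_funsI)
  fix U c assume C: "(U, c) \<in> A"
  have "smooth_on (c ` U \<times> (- {0 :: 'e})) (\<lambda>z. h (inv_into U c (fst z)))"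
    by (rule smooth_on_compose[OF slit_open[OF C] atlas_open_image[OF C] smooth_funsD[OF h C]])
       (auto intro: smooth_on_linear bounded_linear_fst)
  then show "\<exists>F. smooth_on (c ` U \<times> (- {0 :: 'e})) F \<and>
    (\<forall>x w. x \<in> c ` U \<longrightarrow> w \<noteq> 0 \<longrightarrow>
      h (fst (inv_into U c x, chart_vector A (U, c) (inv_into U c x) w)) = F (x, w))"
    by (intro exI conjI) auto
qed

text \<open>In a chart the function is the derivative of \<open>h\<close> at \<open>x\<close> in the
  direction \<open>w\<close>, with both arguments variable.\<close>

lemma smooth_funs_snd:
  assumes h: "h \<in> smooth_funs A"
  shows "(\<lambda>u. snd u h) \<in> smooth_funs (slit_atlas A)"
proof (rule slit_smooth_funsI)
  fix U c assume C: "(U, c) \<in> A"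
  have "smooth_on (c ` U \<times> (- {0 :: 'e})) (\<lambda>z. frechet_derivative (h \<circ> inv_into U c) (at (fst z)) (snd z))"
    by (rule smooth_on_frechet_derivative_apply[OF slit_open[OF C] atlas_open_image[OF C]])
       (use smooth_funsD[OF h C] in \<open>auto intro: smooth_on_linear bounded_linear_fst bounded_linear_snd simp: o_def\<close>)
  then show "\<exists>F. smooth_on (c ` U \<times> (- {0 :: 'e})) F \<and>
    (\<forall>x w. x \<in> c ` U \<longrightarrow> w \<noteq> 0 \<longrightarrow>
      snd (inv_into U c x, chart_vector A (U, c) (inv_into U c x) w) h = F (x, w))"
    by (intro exI[of _ "\<lambda>z. frechet_derivative (h \<circ> inv_into U c) (at (fst z)) (snd z)"] conjI)
       (simp_all add: chart_vector_def h f_inv_into_f)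
qed

text \<open>A global substitute for a bundle chart: the components of a tangent vector are its
  values on the coordinate functions, so both halves are built from the same
  \<open>h\<close>.\<close>

definition slit_xy :: "('e \<Rightarrow> 'a \<Rightarrow> real) \<Rightarrow> 'a tb \<Rightarrow> 'e \<times> 'e" where
  "slit_xy h u = (\<Sum>b\<in>Basis. h b (fst u) *\<^sub>R b, \<Sum>b\<in>Basis. snd u (h b) *\<^sub>R b)"

lemma slit_xy_smooth:
  assumes "chart_coords A U c p h s"
  shows "(\<lambda>u. slit_xy h u \<bullet> \<beta>) \<in> smooth_funs (slit_atlas A)"
proof -
  have "h b \<in> smooth_funs A" if "b \<in> Basis" for b
    using assms that unfolding chart_coords_def by blast
  then have "(\<lambda>u. (\<Sum>b\<in>Basis. (b \<bullet> fst \<beta>) * h b (fst u)) + (\<Sum>b\<in>Basis. (b \<bullet> snd \<beta>) * snd u (h b)))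
      \<in> smooth_funs (slit_atlas A)"
    by (intro TM.smooth_funs_add TM.smooth_funs_sum TM.smooth_funs_scale smooth_funs_fst smooth_funs_snd)
  then show ?thesis
    by (simp add: slit_xy_def inner_prod_def inner_sum_left mult.commute)
qed

lemma slit_xy_eq_slit_map:
  assumes C: "(U, c) \<in> A" and h: "chart_coords A U c p h s"
    and u: "u \<in> slit_dom U" "c (fst u) \<in> ball (c p) s"
  shows "slit_xy h u = slit_map U c u"
proof -
  obtain q w where qw: "q \<in> U" "w \<noteq> 0" "u = (q, chart_vector A (U, c) q w)"
    by (rule slit_dom_cases[OF C u(1)])
  obtain s' where h': "chart_coords A U c q h s'"
    by (rule chart_coords_near[OF h qw(1)]) (use u(2) qw(3) in auto)
  have "h b q = c q \<bullet> b" if "b \<in> Basis" for b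
    using h that qw u(2) unfolding chart_coords_def by auto
  moreover have "chart_vector A (U, c) q w (h b) = w \<bullet> b" if "b \<in> Basis" for b
    by (rule chart_vector_coord[OF C qw(1) h' that])
  ultimately have "slit_xy h u = (c q, w)"
    unfolding slit_xy_def qw(3) by (simp add: euclidean_representation)
  then show ?thesis using slit_map_chart_vector[OF C qw(1), of w] unfolding qw(3) by simp
qed

lemma slit_map_ball_fst:
  assumes "slit_map U c u \<in> ball (slit_map U c v) s"
  shows "c (fst u) \<in> ball (c (fst v)) s"
  using assms dist_fst_le[of "slit_map U c v" "slit_map U c u"] by (auto simp: slit_map_def)

text \<open>Bumps on the slit bundle are products of a bump on \<open>M\<close> and a Euclidean bump in the globally
  defined smooth functions \<open>slit_xy\<close>; this avoids the transition maps of the slit bundle.\<close>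

sublocale TM: charted "slit_atlas A"
proof
  fix U' c' u and r :: real
  assume "(U', c') \<in> slit_atlas A" and u: "u \<in> U'" and r: "0 < r" and sub: "ball (c' u) r \<subseteq> c' ` U'"
  then obtain U c where C: "(U, c) \<in> A" and eq: "U' = slit_dom U" "c' = slit_map U c"
    unfolding slit_atlas_iff by blast
  have p: "fst u \<in> U" using u eq by simp
  obtain h s where h: "chart_coords A U c (fst u) h s" by (rule ex_chart_coords[OF C p])
  then have s: "0 < s" unfolding chart_coords_def by blast
  obtain r1 where r1: "0 < r1" "r1 \<le> s" "ball (c (fst u)) r1 \<subseteq> c ` U" by (rule ex_ball[OF C p s])
  obtain s1 \<psi>0 where \<psi>0: "chart_bump A U c (fst u) r1 s1 \<psi>0" using ex_bump[OF C p r1(1,3)] by blast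
  define \<psi>1 where "\<psi>1 = (\<lambda>q. if q \<in> U \<and> c q \<in> ball (c (fst u)) r1 then \<psi>0 q * 1 else 0)"
  have \<psi>1s: "\<psi>1 \<in> smooth_funs A"
    using \<psi>0 smooth_on_const unfolding chart_bump_def \<psi>1_def by blast
  have s1: "0 < s1" "s1 \<le> r1" using \<psi>0 unfolding chart_bump_def by auto
  have \<psi>11: "\<psi>1 q = 1" if "q \<in> U" "c q \<in> ball (c (fst u)) s1" for q
    using \<psi>0 that s1 unfolding chart_bump_def \<psi>1_def by auto
  obtain \<theta> :: "'e \<times> 'e \<Rightarrow> real" where \<theta>: "smooth_on UNIV \<theta>"
    "\<And>x. x \<in> ball (c' u) (r / 3) \<Longrightarrow> \<theta> x = 1" "\<And>x. x \<notin> cball (c' u) (r / 2) \<Longrightarrow> \<theta> x = 0"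
    using smooth_bump_exists[OF r] by blast
  define \<psi> where "\<psi> = (\<lambda>v. \<psi>1 (fst v) * \<theta> (slit_xy h v))"
  have xy: "slit_xy h v = c' v" if "v \<in> U'" "c (fst v) \<in> ball (c (fst u)) s" for v
    using slit_xy_eq_slit_map[OF C h] that unfolding eq by blast
  \<comment> \<open>Within \<open>s1\<close> the factor coming from the manifold is 1, within
    \<open>r / 3\<close> the Euclidean one is; \<open>slit_xy h\<close> agrees with the chart there
    since \<open>s1 \<le> r1 \<le> s\<close>.\<close>
  have "chart_bump (slit_atlas A) U' c' u r (min s1 (r / 3)) \<psi>"
    unfolding chart_bump_def
  proof (intro conjI ballI allI impI)
    fix v assume v: "v \<in> U'" "c' v \<in> ball (c' u) (min s1 (r / 3))"
    then have "c (fst v) \<in> ball (c (fst u)) (min s1 (r / 3))"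
      using slit_map_ball_fst unfolding eq by blast
    moreover have "fst v \<in> U" using v(1) eq by simp
    ultimately show "\<psi> v = 1"
      unfolding \<psi>_def using \<psi>11[of "fst v"] xy[OF v(1)] \<theta>(2)[of "c' v"] v(2) s1 r1(2) by auto
  next
    fix g :: "'e \<times> 'e \<Rightarrow> real"
    assume g: "smooth_on (ball (c' u) r) g"
    let ?G = "\<lambda>x. if x \<in> ball (c' u) r then \<theta> x * g x else 0"
    have "smooth_on UNIV ?G"
      by (rule smooth_on_bump_extension[where \<delta> = "r / 2", OF \<theta>(1)])
         (fact \<theta>(3), use r in simp, fact g)
    then have "(\<lambda>v. \<psi>1 (fst v) * ?G (slit_xy h v)) \<in> smooth_funs (slit_atlas A)"
      using TM.smooth_funs_mult[OF smooth_funs_fst[OF \<psi>1s] TM.smooth_funs_compose[OF slit_xy_smooth[OF h]]]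
      by blast
    then show "(\<lambda>v. if v \<in> U' \<and> c' v \<in> ball (c' u) r then \<psi> v * g (c' v) else 0) \<in> smooth_funs (slit_atlas A)"
    proof (rule TM.smooth_funs_cong)
      fix v assume v: "v \<in> TM.M"
      show "\<psi>1 (fst v) * ?G (slit_xy h v) = (if v \<in> U' \<and> c' v \<in> ball (c' u) r then \<psi> v * g (c' v) else 0)"
      proof (cases "\<psi>1 (fst v) = 0")
        case True
        then show ?thesis by (simp add: \<psi>_def)
      next
        \<comment> \<open>Outside \<open>U'\<close> the value of \<open>slit_xy h\<close> may lie in
          the ball by accident. The factor \<open>\<psi>1\<close> excludes this, as it is 0 unless
          \<open>fst v\<close> lies in \<open>U\<close> near \<open>fst u\<close>.\<close>
        case False
        then have "fst v \<in> U" "c (fst v) \<in> ball (c (fst u)) r1" unfolding \<psi>1_def by (auto split: if_splits)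
        moreover from this have "v \<in> U'" using v slit_cover unfolding eq by auto
        ultimately show ?thesis using xy[of v] r1(2) by (auto simp: \<psi>_def)
      qed
    qed
  qed (use s1 r in auto)
  then show "\<exists>s \<psi>. chart_bump (slit_atlas A) U' c' u r s \<psi>" by blast
qed

lemma slit_coords:
  assumes C: "(U, c) \<in> A" and h: "chart_coords A U c (fst u) h s"
  shows "chart_coords (slit_atlas A) (slit_dom U) (slit_map U c) u (\<lambda>\<beta> v. slit_xy h v \<bullet> \<beta>) s"
  unfolding chart_coords_def
proof (intro conjI ballI impI slit_xy_smooth[OF h])
  show "0 < s" using h unfolding chart_coords_def by blast
  fix \<beta> v assume "v \<in> slit_dom U" "slit_map U c v \<in> ball (slit_map U c u) s"
  then show "slit_xy h v \<bullet> \<beta> = slit_map U c v \<bullet> \<beta>"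
    using slit_xy_eq_slit_map[OF C h, of v] slit_map_ball_fst[of U c v u s] by simp
qed

end

section \<open>Regular connections and horizontal lifts\<close>

context smooth_manifold
begin

lemma rho_apply: "h \<in> smooth_funs A \<Longrightarrow> rho A D h = D (\<lambda>u. h (fst u))"
  by (simp add: rho_def o_def)

lemma rho_add: "rho A (D + E) = rho A D + rho A E"
  by (simp add: rho_def fun_eq_iff)

lemma rho_scale: "rho A (a *\<^sub>v D) = a *\<^sub>v rho A D"
  by (simp add: rho_def fun_eq_iff)

lemma rho_tangent:
  assumes D: "D \<in> tangent_space (slit_atlas A) u"
  shows "rho A D \<in> tangent_space A (fst u)"
proof (rule tangent_spaceI)
  show "rho A D f = 0" if "f \<notin> smooth_funs A" for f
    using that by (simp add: rho_def)
  fix f assume f: "f \<in> smooth_funs A"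
  show "rho A D (\<lambda>q. a * f q) = a * rho A D f" for a
    unfolding rho_apply[OF f] rho_apply[OF smooth_funs_scale[OF f]]
    by (rule TM.tangent_scale[OF D smooth_funs_fst[OF f]])
  fix g assume g: "g \<in> smooth_funs A"
  show "rho A D (\<lambda>q. f q + g q) = rho A D f + rho A D g"
    unfolding rho_apply[OF f] rho_apply[OF g] rho_apply[OF smooth_funs_add[OF f g]]
    by (rule TM.tangent_add[OF D smooth_funs_fst[OF f] smooth_funs_fst[OF g]])
  show "rho A D (\<lambda>q. f q * g q) = rho A D f * g (fst u) + f (fst u) * rho A D g"
    unfolding rho_apply[OF f] rho_apply[OF g] rho_apply[OF smooth_funs_mult[OF f g]]
    by (rule TM.tangent_mult[OF D smooth_funs_fst[OF f] smooth_funs_fst[OF g]])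
qed

text \<open>The differential of the projection drops the fibre components: the pullback of
  \<open>h b\<close> is the coordinate of \<open>slit_xy h\<close> along \<open>(b, 0)\<close>, and
  values on coordinate functions determine a tangent vector.\<close>

lemma rho_chart_vector:
  assumes C: "(U, c) \<in> A" and u: "u \<in> slit_dom U"
  shows "rho A (chart_vector (slit_atlas A) (slit_dom U, slit_map U c) u w) =
    chart_vector A (U, c) (fst u) (fst w)"
proof -
  let ?D = "chart_vector (slit_atlas A) (slit_dom U, slit_map U c) u w"
  have p: "fst u \<in> U" using u by simp
  obtain h s where h: "chart_coords A U c (fst u) h s" by (rule ex_chart_coords[OF C p])
  note C' = slit_atlas_mem[OF C]
  have D: "?D \<in> tangent_space (slit_atlas A) u" by (rule TM.chart_vector_tangent[OF C' u])
  show ?thesis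
  proof (rule tangent_eqI[OF rho_tangent[OF D] chart_vector_tangent[OF C p] C p h])
    fix b :: 'e assume b: "b \<in> Basis"
    have hb: "h b \<in> smooth_funs A" using h b unfolding chart_coords_def by blast
    have "(\<lambda>v. h b (fst v)) = (\<lambda>v. slit_xy h v \<bullet> (b, 0))"
      using b by (simp add: slit_xy_def fun_eq_iff inner_sum_left_Basis)
    then have "rho A ?D (h b) = ?D (\<lambda>v. slit_xy h v \<bullet> (b, 0))"
      by (simp only: rho_apply[OF hb])
    also have "\<dots> = w \<bullet> (b, 0)"
      by (rule TM.chart_vector_coord[OF C' u slit_coords[OF C h]]) (use b in \<open>simp add: Basis_prod_def\<close>)
    also have "\<dots> = chart_vector A (U, c) (fst u) (fst w) (h b)"
      using chart_vector_coord[OF C p h b] by (simp add: inner_prod_def)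
    finally show "rho A ?D (h b) = chart_vector A (U, c) (fst u) (fst w) (h b)" .
  qed
qed

lemma eta_pi_field: "eta \<in> pi_fields A"
  using smooth_funs_snd by (auto simp: pi_fields_def slit_bundle_def)

lemma pi_field_tangent: "X \<in> pi_fields A \<Longrightarrow> u \<in> slit_bundle A \<Longrightarrow> X u \<in> tangent_space A (fst u)"
  and pi_field_smooth: "X \<in> pi_fields A \<Longrightarrow> h \<in> smooth_funs A \<Longrightarrow> (\<lambda>u. X u h) \<in> smooth_funs (slit_atlas A)"
  unfolding pi_fields_def by blast+

lemma slit_chart_cases:
  assumes "u \<in> slit_bundle A"
  obtains U c where "(U, c) \<in> A" "u \<in> slit_dom U"
  using ex_chart[of "fst u"] assms by blast

end

locale regular_pi_connection = smooth_manifold A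
  for A :: "('a::t2_space, 'e::euclidean_space) chart set" +
  fixes nabla :: "'a pi_connection"
  assumes regular: "regular_connection A nabla"
begin

abbreviation K :: "'a tb \<Rightarrow> 'a tb tvec \<Rightarrow> 'a tvec" where
  "K u X \<equiv> nabla u X eta"

lemma linear_conn: "linear_connection A nabla"
  using regular unfolding regular_connection_def by blast

lemma nabla_tangent:
  "u \<in> slit_bundle A \<Longrightarrow> X \<in> tangent_space (slit_atlas A) u \<Longrightarrow> Z \<in> pi_fields A \<Longrightarrow>
    nabla u X Z \<in> tangent_space A (fst u)"
  by (rule linear_conn[unfolded linear_connection_def, THEN conjunct1, rule_format])

lemma nabla_add:
  "u \<in> slit_bundle A \<Longrightarrow> X \<in> tangent_space (slit_atlas A) u \<Longrightarrow> Y \<in> tangent_space (slit_atlas A) u \<Longrightarrow>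
    Z \<in> pi_fields A \<Longrightarrow> nabla u (X + Y) Z = nabla u X Z + nabla u Y Z"
  by (rule linear_conn[unfolded linear_connection_def, THEN conjunct2, THEN conjunct1, rule_format])

lemma nabla_scale:
  "u \<in> slit_bundle A \<Longrightarrow> X \<in> tangent_space (slit_atlas A) u \<Longrightarrow> Z \<in> pi_fields A \<Longrightarrow>
    nabla u (a *\<^sub>v X) Z = a *\<^sub>v nabla u X Z"
  by (rule linear_conn[unfolded linear_connection_def, THEN conjunct2, THEN conjunct2, THEN conjunct1, rule_format])

lemma nabla_Leibniz:
  "u \<in> slit_bundle A \<Longrightarrow> X \<in> tangent_space (slit_atlas A) u \<Longrightarrow> Z \<in> pi_fields A \<Longrightarrow>
    f \<in> smooth_funs (slit_atlas A) \<Longrightarrow>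
    nabla u X (\<lambda>v. f v *\<^sub>v Z v) = X f *\<^sub>v Z u + f u *\<^sub>v nabla u X Z"
  by (rule linear_conn[unfolded linear_connection_def, THEN conjunct2, THEN conjunct2, THEN conjunct2,
        THEN conjunct2, THEN conjunct1, rule_format])

lemma nabla_pi_field:
  "X \<in> vector_fields (slit_atlas A) (slit_bundle A) \<Longrightarrow> Z \<in> pi_fields A \<Longrightarrow>
    (\<lambda>u. nabla u (X u) Z) \<in> pi_fields A"
  by (rule linear_conn[unfolded linear_connection_def, THEN conjunct2, THEN conjunct2, THEN conjunct2,
        THEN conjunct2, THEN conjunct2, rule_format])

section \<open>Horizontal vectors and the map \<open>beta\<close>\<close>

lemma tangent_decomposition:
  assumes "u \<in> slit_bundle A" "X \<in> tangent_space (slit_atlas A) u"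
  obtains V H where "X = V + H" "V \<in> vert A u" "H \<in> hor A nabla u"
proof -
  have "tangent_space (slit_atlas A) u = {X + Y | X Y. X \<in> vert A u \<and> Y \<in> hor A nabla u}"
    using regular assms(1) unfolding regular_connection_def by blast
  then show thesis using assms(2) that by blast
qed

lemma vert_hor_eq_0:
  "u \<in> slit_bundle A \<Longrightarrow> X \<in> tangent_space (slit_atlas A) u \<Longrightarrow> rho A X = 0 \<Longrightarrow> K u X = 0 \<Longrightarrow> X = 0"
  using regular unfolding regular_connection_def vert_def hor_def connection_map_def by blast

lemma hor_iff: "X \<in> hor A nabla u \<longleftrightarrow> X \<in> tangent_space (slit_atlas A) u \<and> K u X = 0"
  by (simp add: hor_def connection_map_def)

lemma hor_add:
  "u \<in> slit_bundle A \<Longrightarrow> X \<in> hor A nabla u \<Longrightarrow> Y \<in> hor A nabla u \<Longrightarrow> X + Y \<in> hor A nabla u"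
  by (simp add: hor_iff TM.add_tangent nabla_add eta_pi_field)

lemma hor_scale:
  "u \<in> slit_bundle A \<Longrightarrow> X \<in> hor A nabla u \<Longrightarrow> a *\<^sub>v X \<in> hor A nabla u"
  by (simp add: hor_iff TM.scale_tangent nabla_scale eta_pi_field zero_fun_def)

lemma rho_inj_on_hor:
  assumes u: "u \<in> slit_bundle A"
  shows "inj_on (rho A) (hor A nabla u)"
proof (rule inj_onI)
  fix X Y assume X: "X \<in> hor A nabla u" and Y: "Y \<in> hor A nabla u" and eq: "rho A X = rho A Y"
  let ?Z = "X + (-1) *\<^sub>v Y"
  have "?Z \<in> hor A nabla u" by (rule hor_add[OF u X hor_scale[OF u Y]])
  moreover have "rho A ?Z = 0" by (simp only: rho_add rho_scale eq) (simp add: fun_eq_iff)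
  ultimately have "?Z = 0" using vert_hor_eq_0[OF u] unfolding hor_iff by blast
  then show "X = Y" by (simp add: fun_eq_iff)
qed

text \<open>Any lift of \<open>v\<close>, here the one with fibre components 0 in a chart, can be
  corrected: its vertical part is annihilated by \<open>rho A\<close>, so its horizontal part still
  projects to \<open>v\<close>.\<close>

lemma rho_hor_surj:
  assumes u: "u \<in> slit_bundle A" and v: "v \<in> tangent_space A (fst u)"
  shows "v \<in> rho A ` hor A nabla u"
proof -
  obtain U c where C: "(U, c) \<in> A" "u \<in> slit_dom U" by (rule slit_chart_cases[OF u])
  then have p: "fst u \<in> U" by simp
  obtain a where a: "v = chart_vector A (U, c) (fst u) a" by (rule chart_vector_surj[OF v C(1) p])
  let ?X = "chart_vector (slit_atlas A) (slit_dom U, slit_map U c) u (a, 0)"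
  have X: "rho A ?X = v" using rho_chart_vector[OF C, of "(a, 0)"] a by simp
  obtain V H where VH: "?X = V + H" "V \<in> vert A u" "H \<in> hor A nabla u"
    by (rule tangent_decomposition[OF u TM.chart_vector_tangent[OF slit_atlas_mem[OF C(1)] C(2)]])
  have "rho A H = v" using X VH(2) unfolding VH(1) rho_add vert_def by simp
  then show ?thesis using VH(3) by blast
qed

lemma
  assumes "u \<in> slit_bundle A" "v \<in> tangent_space A (fst u)"
  shows beta_hor: "beta A nabla u v \<in> hor A nabla u"
    and rho_beta: "rho A (beta A nabla u v) = v"
  unfolding beta_def
  using the_inv_into_into[OF rho_inj_on_hor[OF assms(1)] rho_hor_surj[OF assms] order_refl]
    f_the_inv_into_f[OF rho_inj_on_hor[OF assms(1)] rho_hor_surj[OF assms]] by simp_all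

lemma beta_rho: "u \<in> slit_bundle A \<Longrightarrow> X \<in> hor A nabla u \<Longrightarrow> beta A nabla u (rho A X) = X"
  unfolding beta_def by (rule the_inv_into_f_f[OF rho_inj_on_hor])

lemma beta_tangent:
  "u \<in> slit_bundle A \<Longrightarrow> v \<in> tangent_space A (fst u) \<Longrightarrow> beta A nabla u v \<in> tangent_space (slit_atlas A) u"
  using beta_hor hor_iff by blast

lemma beta_add:
  assumes u: "u \<in> slit_bundle A" and v: "v \<in> tangent_space A (fst u)" and w: "w \<in> tangent_space A (fst u)"
  shows "beta A nabla u (v + w) = beta A nabla u v + beta A nabla u w"
  using beta_rho[OF u hor_add[OF u beta_hor[OF u v] beta_hor[OF u w]]]
  by (simp only: rho_add rho_beta[OF u v] rho_beta[OF u w])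

lemma beta_scale:
  assumes u: "u \<in> slit_bundle A" and v: "v \<in> tangent_space A (fst u)"
  shows "beta A nabla u (a *\<^sub>v v) = a *\<^sub>v beta A nabla u v"
  using beta_rho[OF u hor_scale[OF u beta_hor[OF u v], of a]]
  by (simp only: rho_scale rho_beta[OF u v])

lemma linear_K_chart_vector:
  assumes C: "(U, c) \<in> A" and u: "u \<in> slit_dom U"
  shows "linear (\<lambda>w. K u (chart_vector (slit_atlas A) (slit_dom U, slit_map U c) u w) h)"
proof -
  note C' = slit_atlas_mem[OF C]
  have us: "u \<in> slit_bundle A" using u by simp
  show ?thesis
    by (rule linearI)
       (simp_all add: TM.chart_vector_add[OF C' u] TM.chart_vector_scale[OF C' u]
          nabla_add[OF us TM.chart_vector_tangent[OF C' u] TM.chart_vector_tangent[OF C' u] eta_pi_field]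
          nabla_scale[OF us TM.chart_vector_tangent[OF C' u] eta_pi_field])
qed

text \<open>In a chart, the vertical components of \<open>\<beta>X\<close> solve the linear system \<open>K (\<beta>X) = 0\<close>, whose
  matrix is smooth and, by regularity, invertible.\<close>

lemma hlift_vector_field:
  assumes X: "X \<in> pi_fields A"
  shows "hlift A nabla X \<in> vector_fields (slit_atlas A) (slit_bundle A)"
proof -
  have "(\<lambda>u. beta A nabla u (X u) f) \<in> smooth_funs (slit_atlas A)"
    if f: "f \<in> smooth_funs (slit_atlas A)" for f
  proof (rule TM.smooth_funs_localI)
    fix U' c' u0 assume C': "(U', c') \<in> slit_atlas A" and u0: "u0 \<in> U'"
    then obtain U c where C: "(U, c) \<in> A" and U': "U' = slit_dom U" and c': "c' = slit_map U c"
      unfolding slit_atlas_iff by blast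
    have p0: "fst u0 \<in> U" using u0 U' by simp
    obtain h s where h: "chart_coords A U c (fst u0) h s" by (rule ex_chart_coords[OF C p0])
    then have s: "0 < s" and hs: "\<And>b. b \<in> Basis \<Longrightarrow> h b \<in> smooth_funs A"
      unfolding chart_coords_def by auto
    \<comment> \<open>Global fields that coincide with the coordinate fields near \<open>u0\<close>;
      along them \<open>nabla_pi_field\<close> makes the connection map smooth.\<close>
    obtain V s' where s': "0 < s'" and V: "\<And>w. V w \<in> vector_fields (slit_atlas A) (slit_bundle A)"
      "\<And>w u. u \<in> U' \<Longrightarrow> c' u \<in> ball (c' u0) s' \<Longrightarrow> V w u = chart_vector (slit_atlas A) (U', c') u w"
      by (rule TM.ex_local_frame[OF C' u0, unfolded slit_cover]) (rule that)
    obtain r where r: "0 < r" "r \<le> min s s'" "ball (c' u0) r \<subseteq> c' ` U'"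
      by (rule TM.ex_ball[OF C' u0, of "min s s'"]) (use s s' in auto)
    let ?T = "ball (c' u0) r"
    let ?q = "inv_into U' c'"
    have qU: "?q z \<in> U'" and cq: "c' (?q z) = z" if "z \<in> ?T" for z
      by (rule inv_into_into[OF subsetD[OF r(3) that]], rule f_inv_into_f[OF subsetD[OF r(3) that]])
    have qs: "?q z \<in> slit_bundle A" and qf: "fst (?q z) \<in> U" if "z \<in> ?T" for z
      using qU[OF that] U' by auto
    have Vq: "V w (?q z) = chart_vector (slit_atlas A) (U', c') (?q z) w" if "z \<in> ?T" for w z
      by (rule V(2)[OF qU[OF that]]) (use that cq[OF that] r(2) in simp)
    have hq: "\<exists>s. chart_coords A U c (fst (?q z)) h s" if "z \<in> ?T" for z
    proof -
      have "c' (?q z) \<in> ball (c' u0) s" using that cq[OF that] r(2) by simp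
      then have "c (fst (?q z)) \<in> ball (c (fst u0)) s" unfolding c' by (rule slit_map_ball_fst)
      then show ?thesis using chart_coords_near[OF h qf[OF that]] by blast
    qed
    define \<xi> where "\<xi> z = (\<Sum>b\<in>Basis. X (?q z) (h b) *\<^sub>R b)" for z
    \<comment> \<open>The coordinate matrix of the connection map, written with the global fields
      \<open>V w\<close> so that its smoothness in \<open>z\<close> is available.\<close>
    define \<Lambda> where "\<Lambda> z w = (\<Sum>j\<in>Basis. K (?q z) (V w (?q z)) (h j) *\<^sub>R j)" for z w
    have sm: "smooth_on ?T (\<lambda>z. F (?q z))" if "F \<in> smooth_funs (slit_atlas A)" for F
      using TM.smooth_funsD[OF that C'] r(3) by (rule smooth_on_subset)
    have \<xi>s: "smooth_on ?T \<xi>"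
      unfolding \<xi>_def
      by (intro smooth_on_sum smooth_on_scaleR smooth_on_const open_ball
          sm[of "\<lambda>u. X u (h b)" for b] pi_field_smooth[OF X] hs)
    have \<Lambda>s: "smooth_on ?T (\<lambda>z. \<Lambda> z w)" for w
      unfolding \<Lambda>_def
      by (intro smooth_on_sum smooth_on_scaleR smooth_on_const open_ball
          sm[of "\<lambda>u. K u (V w u) (h b)" for b] pi_field_smooth[OF nabla_pi_field[OF V(1) eta_pi_field]] hs)
    have Klin: "linear (\<lambda>w. K u (chart_vector (slit_atlas A) (U', c') u w) j)" if "u \<in> U'" for u j
      using linear_K_chart_vector[OF C] that unfolding U' c' by blast
    have rc: "rho A (chart_vector (slit_atlas A) (U', c') u w) = chart_vector A (U, c) (fst u) (fst w)"
      if "u \<in> U'" for u w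
      using rho_chart_vector[OF C] that unfolding U' c' by blast
    have \<Lambda>lin: "linear (\<Lambda> z)" if z: "z \<in> ?T" for z
      unfolding \<Lambda>_def Vq[OF z]
      by (rule linearI)
         (simp_all add: linear_add[OF Klin[OF qU[OF z]]] linear_scale[OF Klin[OF qU[OF z]]]
           scaleR_add_left sum.distrib scaleR_sum_right)
    have \<Lambda>0: "K (?q z) (chart_vector (slit_atlas A) (U', c') (?q z) w) = 0"
      if z: "z \<in> ?T" and w: "\<Lambda> z w = 0" for z w
    proof -
      obtain t where t: "chart_coords A U c (fst (?q z)) h t" using hq[OF z] by blast
      have "K (?q z) (V w (?q z)) (h j) = 0" if "j \<in> Basis" for j
        using arg_cong[OF w, of "\<lambda>x. x \<bullet> j"] that
        by (simp add: \<Lambda>_def inner_sum_left_Basis)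
      then show ?thesis
        unfolding Vq[OF z]
        by (intro tangent_eqI[OF nabla_tangent[OF qs[OF z] TM.chart_vector_tangent[OF C' qU[OF z]] eta_pi_field]
              zero_tangent C qf[OF z] t]) simp
    qed
    \<comment> \<open>Since \<open>rho A\<close> sends the lift back to \<open>X\<close>, the base
      part of its components is forced to be \<open>\<xi> z\<close>; only the fibre part remains
      unknown.\<close>
    have "\<exists>a. beta A nabla (?q z) (X (?q z)) = chart_vector (slit_atlas A) (U', c') (?q z) (\<xi> z, a)"
      if z: "z \<in> ?T" for z
    proof -
      let ?u = "?q z"
      obtain t where t: "chart_coords A U c (fst ?u) h t" using hq[OF z] by blast
      note Xt = pi_field_tangent[OF X qs[OF z]]
      obtain w where w: "beta A nabla ?u (X ?u) = chart_vector (slit_atlas A) (U', c') ?u w"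
        by (rule TM.chart_vector_surj[OF beta_tangent[OF qs[OF z] Xt] C' qU[OF z]])
      have "X ?u = chart_vector A (U, c) (fst ?u) (fst w)"
        using rho_beta[OF qs[OF z] Xt] unfolding w rc[OF qU[OF z]] by (rule sym)
      then have "X ?u (h b) = fst w \<bullet> b" if "b \<in> Basis" for b
        using chart_vector_coord[OF C qf[OF z] t that] by simp
      then have "\<xi> z = fst w" unfolding \<xi>_def by (simp add: euclidean_representation)
      then show ?thesis using w by (metis prod.collapse)
    qed
    then obtain a where a: "\<And>z. z \<in> ?T \<Longrightarrow>
        beta A nabla (?q z) (X (?q z)) = chart_vector (slit_atlas A) (U', c') (?q z) (\<xi> z, a z)"
      by metis
    have as: "smooth_on ?T a"
    proof (rule smooth_on_linear_solution[where K = "\<lambda>b z. \<Lambda> z (0, b)"])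
      show "open ?T" by simp
      show "smooth_on ?T (\<lambda>z. \<Lambda> z (0, b))" for b by (rule \<Lambda>s)
      have "smooth_on ?T (\<lambda>z. (-1) *\<^sub>R (\<Sum>b\<in>Basis. (\<xi> z \<bullet> b) *\<^sub>R \<Lambda> z (b, 0)))"
        by (intro smooth_on_sum smooth_on_scaleR smooth_on_const open_ball \<Lambda>s
            smooth_on_bounded_linear[OF open_ball bounded_linear_inner_left \<xi>s])
      then show "smooth_on ?T (\<lambda>z. - (\<Sum>b\<in>Basis. (\<xi> z \<bullet> b) *\<^sub>R \<Lambda> z (b, 0)))" by simp
      fix z assume z: "z \<in> ?T"
      interpret linear "\<Lambda> z" by (rule \<Lambda>lin[OF z])
      have vsum: "(\<Sum>b\<in>Basis. (v \<bullet> b) *\<^sub>R \<Lambda> z (0, b)) = \<Lambda> z (0, v)" for v :: 'e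
      proof -
        have "(0, v) = (\<Sum>b\<in>Basis. (v \<bullet> b) *\<^sub>R (0 :: 'e, b))"
          by (simp add: prod_eq_iff fst_sum snd_sum euclidean_representation)
        then show ?thesis by (simp only: sum scale)
      qed
      have hsum: "(\<Sum>b\<in>Basis. (v \<bullet> b) *\<^sub>R \<Lambda> z (b, 0)) = \<Lambda> z (v, 0)" for v :: 'e
      proof -
        have "(v, 0) = (\<Sum>b\<in>Basis. (v \<bullet> b) *\<^sub>R (b, 0 :: 'e))"
          by (simp add: prod_eq_iff fst_sum snd_sum euclidean_representation)
        then show ?thesis by (simp only: sum scale)
      qed
      \<comment> \<open>A vector in the kernel of the fibre block would be vertical and horizontal
        at once.\<close>
      show "v = 0" if "(\<Sum>b\<in>Basis. (v \<bullet> b) *\<^sub>R \<Lambda> z (0, b)) = 0" for v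
      proof -
        let ?D = "chart_vector (slit_atlas A) (U', c') (?q z) (0, v)"
        have "rho A ?D = 0"
          unfolding rc[OF qU[OF z]] using chart_vector_zero_iff[OF C qf[OF z]] by simp
        then have "?D = 0"
          using vert_hor_eq_0[OF qs[OF z] TM.chart_vector_tangent[OF C' qU[OF z]]]
            \<Lambda>0[OF z] that unfolding vsum by blast
        then show ?thesis using TM.chart_vector_zero_iff[OF C' qU[OF z], of "(0, v)"] by (simp add: prod_eq_iff)
      qed
      have "K (?q z) (V (\<xi> z, a z) (?q z)) = 0"
        using beta_hor[OF qs[OF z] pi_field_tangent[OF X qs[OF z]]]
        unfolding hor_iff a[OF z] Vq[OF z] by blast
      then have "\<Lambda> z (\<xi> z, a z) = 0" by (simp add: \<Lambda>_def)
      moreover have "(\<xi> z, a z) = (\<xi> z, 0) + (0, a z)" by simp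
      ultimately have "\<Lambda> z (\<xi> z, 0) + \<Lambda> z (0, a z) = 0" by (metis add)
      then show "(\<Sum>b\<in>Basis. (a z \<bullet> b) *\<^sub>R \<Lambda> z (0, b)) = - (\<Sum>b\<in>Basis. (\<xi> z \<bullet> b) *\<^sub>R \<Lambda> z (b, 0))"
        unfolding vsum hsum by (simp add: eq_neg_iff_add_eq_0 add.commute)
    qed
    have "smooth_on ?T (\<lambda>z. frechet_derivative (f \<circ> ?q) (at z) (\<xi> z, a z))"
      by (rule smooth_on_frechet_derivative_apply[where g = "\<lambda>z. z", OF open_ball open_ball])
         (use sm[OF f] \<xi>s as in \<open>auto simp: o_def smooth_on_linear intro: smooth_on_Pair\<close>)
    moreover have eq: "frechet_derivative (f \<circ> ?q) (at z) (\<xi> z, a z) = beta A nabla (?q z) (X (?q z)) f"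
      if z: "z \<in> ?T" for z
      unfolding a[OF z] using f cq[OF z] by (simp add: chart_vector_def)
    ultimately have "smooth_on ?T (\<lambda>z. beta A nabla (?q z) (X (?q z)) f)"
      by (intro smooth_on_cong[OF open_ball eq, THEN iffD1])
    then show "\<exists>T. open T \<and> c' u0 \<in> T \<and> smooth_on T (\<lambda>z. beta A nabla (?q z) (X (?q z)) f)"
      using r(1) by (intro exI[of _ ?T]) simp
  qed
  moreover have "beta A nabla u (X u) \<in> tangent_space (slit_atlas A) u" if "u \<in> slit_bundle A" for u
    by (rule beta_tangent[OF that pi_field_tangent[OF X that]])
  ultimately show ?thesis
    unfolding vector_fields_def hlift_def by (intro CollectI conjI ballI)
qed

end

section \<open>Gradients\<close>

lemma deriv_along_line:
  fixes \<phi> :: "'e::euclidean_space \<Rightarrow> real"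
  assumes "smooth_on S \<phi>" "y \<in> S"
  shows "deriv (\<lambda>t. \<phi> (y + t *\<^sub>R b)) 0 = frechet_derivative \<phi> (at y) b"
proof (rule DERIV_imp_deriv)
  note d = smooth_on_has_derivative[OF assms]
  have l: "((\<lambda>t. y + t *\<^sub>R b) has_derivative (\<lambda>h. h *\<^sub>R b)) (at 0)"
    by (auto intro!: derivative_eq_intros)
  have "((\<lambda>t. \<phi> (y + t *\<^sub>R b)) has_derivative (\<lambda>h. frechet_derivative \<phi> (at y) (h *\<^sub>R b))) (at 0)"
    by (rule has_derivative_compose[where f = "\<lambda>t. y + t *\<^sub>R b" and g = \<phi>, OF l]) (use d in simp)
  moreover have "frechet_derivative \<phi> (at y) (h *\<^sub>R b) = frechet_derivative \<phi> (at y) b * h" for h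
    using linear_scale[OF has_derivative_linear[OF d], of h b] by simp
  ultimately show "((\<lambda>t. \<phi> (y + t *\<^sub>R b)) has_field_derivative frechet_derivative \<phi> (at y) b) (at 0)"
    by (simp add: has_field_derivative_def)
qed

text \<open>The inner derivative is a directional derivative of \<open>\<phi>\<close> only while
  \<open>y + s *\<^sub>R a\<close> stays in \<open>S\<close>. As \<open>S\<close> is open this holds
  for \<open>s\<close> near 0, which is all that the outer \<open>deriv\<close> sees.\<close>

lemma second_deriv_along_lines:
  fixes \<phi> :: "'e::euclidean_space \<Rightarrow> real"
  assumes S: "open S" and \<phi>: "smooth_on S \<phi>" and y: "y \<in> S"
  shows "deriv (\<lambda>s. deriv (\<lambda>t. \<phi> (y + s *\<^sub>R a + t *\<^sub>R b)) 0) 0 =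
    frechet_derivative (\<lambda>y. frechet_derivative \<phi> (at y) b) (at y) a"
proof -
  have "((\<lambda>s. y + s *\<^sub>R a) \<longlongrightarrow> y + 0 *\<^sub>R a) (nhds (0::real))"
    by (intro tendsto_intros filterlim_ident)
  then have "\<forall>\<^sub>F s in nhds 0. y + s *\<^sub>R a \<in> S"
    by (rule topological_tendstoD) (use S y in simp_all)
  then have "\<forall>\<^sub>F s in nhds 0. deriv (\<lambda>t. \<phi> (y + s *\<^sub>R a + t *\<^sub>R b)) 0 = frechet_derivative \<phi> (at (y + s *\<^sub>R a)) b"
    by (rule eventually_mono) (rule deriv_along_line[OF \<phi>])
  from deriv_cong_ev[OF this refl] show ?thesis
    using deriv_along_line[OF smooth_on_frechet_derivative[OF \<phi>] y] by simp
qed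

text \<open>Positivity on the diagonal makes the map from \<open>a\<close> to the coefficients of
  \<open>H a\<close> injective, hence surjective in finite dimension; existence and uniqueness come
  together.\<close>

lemma positive_bilinear_representation:
  fixes H :: "'e::euclidean_space \<Rightarrow> 'e \<Rightarrow> real"
  assumes H1: "\<And>b. linear (\<lambda>a. H a b)" and H2: "\<And>a. linear (H a)"
    and pos: "\<And>a. a \<noteq> 0 \<Longrightarrow> H a a > 0" and l: "linear l"
  shows "\<exists>!a. \<forall>b. H a b = l b"
proof -
  let ?G = "\<lambda>a. \<Sum>j\<in>Basis. H a j *\<^sub>R j"
  have G: "linear ?G"
    by (rule linearI)
       (simp_all add: linear_add[OF H1] linear_scale[OF H1] scaleR_add_left sum.distrib scaleR_sum_right)
  have ext: "F v = F' v" if "linear F" "linear F'" "\<And>j. j \<in> Basis \<Longrightarrow> F j = F' j" for F F' :: "'e \<Rightarrow> real" and v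
    using linear_eq_on[OF that(1,2), of v Basis] that(3) by (simp add: span_Basis)
  have zero: "a = 0" if "\<And>b. H a b = 0" for a
    using pos[of a] that[of a] by fastforce
  have inj: "inj ?G"
    unfolding linear_injective_0[OF G]
  proof (intro allI impI)
    fix a assume G0: "?G a = 0"
    have "H a j = 0" if "j \<in> Basis" for j
      using arg_cong[OF G0, of "\<lambda>x. x \<bullet> j"] that by (simp add: inner_sum_left_Basis)
    then have "H a b = 0" for b
      using ext[OF H2[of a] linear_zero, of b] by simp
    then show "a = 0" by (rule zero)
  qed
  from surjD[OF linear_injective_imp_surjective[OF G inj refl], of "\<Sum>j\<in>Basis. l j *\<^sub>R j"]
  obtain a where a: "(\<Sum>j\<in>Basis. l j *\<^sub>R j) = ?G a" ..
  have "H a j = l j" if "j \<in> Basis" for j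
    using arg_cong[OF a, of "\<lambda>x. x \<bullet> j"] that by (simp add: inner_sum_left_Basis)
  then have "H a b = l b" for b by (rule ext[OF H2 l])
  moreover have "a' = a" if "\<forall>b. H a' b = l b" for a'
  proof -
    have "H (a' - a) b = 0" for b
      using linear_diff[OF H1[of b]] that \<open>H a b = l b\<close> by simp
    then have "a' - a = 0" by (rule zero)
    then show ?thesis by simp
  qed
  ultimately show ?thesis by blast
qed

context smooth_manifold
begin

text \<open>In the fibre coordinates of a chart the metric is the second derivative of half the
  squared Finsler function on the punctured vector space, which is smooth there.\<close>

lemma finsler_metric_bilinear:
  assumes L: "L \<in> smooth_funs (slit_atlas A)" and C: "(U, c) \<in> A" and u: "u \<in> slit_dom U"
  obtains H :: "'e \<Rightarrow> 'e \<Rightarrow> real" where "\<And>b. linear (\<lambda>a. H a b)" "\<And>a. linear (H a)"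
    "\<And>a b. finsler_metric L u (chart_vector A (U, c) (fst u) a) (chart_vector A (U, c) (fst u) b) = H a b"
proof -
  obtain p y where pw: "p \<in> U" "y \<noteq> 0" "u = (p, chart_vector A (U, c) p y)"
    by (rule slit_dom_cases[OF C u])
  let ?v = "chart_vector A (U, c) p"
  let ?S = "- {0 :: 'e}"
  have S: "open ?S" by auto
  define \<phi> where "\<phi> w = 1/2 * (L (p, ?v w))\<^sup>2" for w
  have iv: "inv_into U c (c p) = p" using chart_inj[OF C] pw(1) by simp
  have pr: "smooth_on ?S (\<lambda>w. (c p, w))"
    by (rule smooth_on_Pair[OF S smooth_on_const smooth_on_linear[OF bounded_linear_ident]])
  have "smooth_on ?S (\<lambda>w. L (inv_into (slit_dom U) (slit_map U c) (c p, w)))"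
    by (rule smooth_on_compose[OF S TM.chart_open[OF slit_atlas_mem[OF C]]
          TM.smooth_funsD[OF L slit_atlas_mem[OF C]] pr])
       (use pw(1) in \<open>auto simp: slit_map_image[OF C]\<close>)
  then have Ls: "smooth_on ?S (\<lambda>w. L (p, ?v w))"
    by (rule smooth_on_cong[OF S, THEN iffD1, rotated])
       (use inv_slit_map[OF C imageI[OF pw(1)]] iv in simp)
  have \<phi>: "smooth_on ?S \<phi>"
    unfolding \<phi>_def power2_eq_square
    by (intro smooth_on_mult S smooth_on_const Ls)
  let ?H = "\<lambda>a b. frechet_derivative (\<lambda>y. frechet_derivative \<phi> (at y) b) (at y) a"
  have ys: "y \<in> ?S" using pw(2) by simp
  have H1: "linear (\<lambda>a. ?H a b)" for b
    by (rule has_derivative_linear[OF smooth_on_has_derivative[OF smooth_on_frechet_derivative[OF \<phi>] ys]])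
  have lin: "linear (frechet_derivative \<phi> (at z))" if "z \<in> ?S" for z
    by (rule has_derivative_linear[OF smooth_on_has_derivative[OF \<phi> that]])
  note d = smooth_on_has_derivative[OF smooth_on_frechet_derivative[OF \<phi>] ys]
  \<comment> \<open>The first derivative is linear in \<open>b\<close> at every point of the
    punctured space, so this linearity survives differentiation in the direction
    \<open>a\<close>.\<close>
  have H2: "linear (?H a)" for a
  proof (rule linearI)
    fix b b' and k :: real
    have "((\<lambda>z. frechet_derivative \<phi> (at z) (b + b')) has_derivative (\<lambda>a. ?H a b + ?H a b')) (at y)"
      by (rule has_derivative_transform_within_open[OF has_derivative_add[OF d d] S ys])
         (simp add: linear_add[OF lin])
    from fun_cong[OF frechet_derivative_at[OF this], of a, symmetric]
    show "?H a (b + b') = ?H a b + ?H a b'" .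
    have "((\<lambda>z. frechet_derivative \<phi> (at z) (k *\<^sub>R b)) has_derivative (\<lambda>a. k *\<^sub>R ?H a b)) (at y)"
      by (rule has_derivative_transform_within_open[OF has_derivative_scaleR_right[OF d] S ys])
         (simp add: linear_scale[OF lin])
    from fun_cong[OF frechet_derivative_at[OF this], of a, symmetric]
    show "?H a (k *\<^sub>R b) = k *\<^sub>R ?H a b" .
  qed
  have "finsler_metric L u (?v a) (?v b) = ?H a b" for a b
  proof -
    have "snd u + s *\<^sub>v ?v a + t *\<^sub>v ?v b = ?v (y + s *\<^sub>R a + t *\<^sub>R b)" for s t
      by (simp add: pw(3) chart_vector_add[OF C pw(1)] chart_vector_scale[OF C pw(1)])
    then have "finsler_metric L u (?v a) (?v b) = deriv (\<lambda>s. deriv (\<lambda>t. \<phi> (y + s *\<^sub>R a + t *\<^sub>R b)) 0) 0"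
      unfolding finsler_metric_def \<phi>_def pw(3) by simp
    then show ?thesis using second_deriv_along_lines[OF S \<phi> ys] by simp
  qed
  then show thesis using that[of ?H, OF H1 H2] pw(3) by simp
qed

end

context regular_pi_connection
begin

text \<open>Here the \<open>THE\<close> in \<open>grad\<close> is resolved: in chart components the
  functional given by \<open>beta\<close> and \<open>f\<close> is linear and the metric is a
  positive bilinear form, so exactly one vector represents it.\<close>

lemma metric_dual_grad:
  assumes L: "finsler_structure A L" and u: "u \<in> slit_bundle A" and w: "w \<in> tangent_space A (fst u)"
  shows "metric_dual L (grad A L nabla f) u w = beta A nabla u w f"
proof -
  obtain U c where C: "(U, c) \<in> A" and uU: "u \<in> slit_dom U" by (rule slit_chart_cases[OF u])
  have p: "fst u \<in> U" using uU by simp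
  let ?v = "chart_vector A (U, c) (fst u)"
  have Ls: "L \<in> smooth_funs (slit_atlas A)"
    and pos: "\<And>v. v \<in> tangent_space A (fst u) \<Longrightarrow> v \<noteq> 0 \<Longrightarrow> finsler_metric L u v v > 0"
    using L u unfolding finsler_structure_def by blast+
  obtain H where H: "\<And>b. linear (\<lambda>a. H a b)" "\<And>a. linear (H a)"
    "\<And>a b. finsler_metric L u (?v a) (?v b) = H a b"
    by (rule finsler_metric_bilinear[OF Ls C uU]) (rule that)
  have vt: "?v a \<in> tangent_space A (fst u)" for a by (rule chart_vector_tangent[OF C p])
  have Hpos: "H a a > 0" if "a \<noteq> 0" for a
    using pos[OF vt] chart_vector_zero_iff[OF C p] that by (simp add: H(3)[symmetric])
  have lin: "linear (\<lambda>b. beta A nabla u (?v b) f)"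
    by (rule linearI)
       (simp_all add: chart_vector_add[OF C p] chart_vector_scale[OF C p] beta_add[OF u vt vt] beta_scale[OF u vt])
  obtain a where a: "\<And>b. H a b = beta A nabla u (?v b) f"
    and uniq: "\<And>a'. (\<forall>b. H a' b = beta A nabla u (?v b) f) \<Longrightarrow> a' = a"
    using positive_bilinear_representation[OF H(1,2) Hpos lin] by blast
  have surj: "\<exists>b. x = ?v b" if "x \<in> tangent_space A (fst u)" for x
    using chart_vector_surj[OF that C p] by blast
  have "grad A L nabla f u = ?v a"
    unfolding grad_def dbar_fun_def
  proof (rule the_equality, rule conjI[OF vt], rule ballI)
    fix x assume "x \<in> tangent_space A (fst u)"
    then obtain b where "x = ?v b" using surj by blast
    then show "finsler_metric L u (?v a) x = beta A nabla u x f" using H(3) a by simp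
  next
    fix x assume x: "x \<in> tangent_space A (fst u) \<and>
      (\<forall>w\<in>tangent_space A (fst u). finsler_metric L u x w = beta A nabla u w f)"
    then obtain a' where a': "x = ?v a'" using surj by blast
    have "H a' b = beta A nabla u (?v b) f" for b
      using bspec[OF conjunct2[OF x[unfolded a']] vt[of b]] unfolding H(3) .
    then show "x = ?v a" using uniq a' by blast
  qed
  moreover obtain b where "w = ?v b" using surj[OF w] by blast
  ultimately show ?thesis unfolding metric_dual_def using H(3) a by simp
qed

section \<open>Flatness of the horizontal distribution and the square of the horizontal
  differential\<close>

lemma nabla_vanishing_field:
  assumes u: "u \<in> slit_bundle A" and X: "X \<in> tangent_space (slit_atlas A) u"
    and Z: "Z \<in> pi_fields A" "\<And>v. v \<in> slit_bundle A \<Longrightarrow> Z v = 0"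
  shows "nabla u X Z = 0"
proof -
  \<comment> \<open>\<open>Z\<close> is arbitrary off the slit bundle, yet equals its own multiple
    by this smooth indicator function; in the Leibniz formula the factors \<open>Z u\<close> and
    \<open>?k u\<close> are both 0.\<close>
  let ?k = "\<lambda>v. if v \<in> slit_bundle A then 0 else 1 :: real"
  have k: "?k \<in> smooth_funs (slit_atlas A)"
    by (rule TM.smooth_funs_cong[OF TM.smooth_funs_const]) (use slit_cover in auto)
  have "(\<lambda>v. ?k v *\<^sub>v Z v) = Z" using Z(2) by (auto simp: fun_eq_iff)
  then have "nabla u X Z = X ?k *\<^sub>v Z u + ?k u *\<^sub>v nabla u X Z"
    using nabla_Leibniz[OF u X Z(1) k] by simp
  then show ?thesis using u Z(2)[OF u] by (simp add: fun_eq_iff)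
qed

text \<open>The inner covariant derivatives are known to vanish on the slit bundle only, so
  \<open>nabla_vanishing_field\<close> is required to discard them. The bracket keeps a plus sign by
  the convention in \<open>curvature\<close>.\<close>

lemma R_hat_eq_K_bracket:
  assumes X: "X \<in> pi_fields A" and Y: "Y \<in> pi_fields A" and u: "u \<in> slit_bundle A"
  shows "R_hat A nabla X Y u =
    K u (lie_bracket (slit_atlas A) (hlift A nabla X) (hlift A nabla Y) u)"
proof -
  have Kh: "K v (hlift A nabla W v) = 0" if "W \<in> pi_fields A" "v \<in> slit_bundle A" for W v
    using beta_hor[OF that(2) pi_field_tangent[OF that]] unfolding hor_iff hlift_def by blast
  have "nabla u (hlift A nabla W u) (\<lambda>v. K v (hlift A nabla W' v)) = 0"
    if W: "W \<in> pi_fields A" and W': "W' \<in> pi_fields A" for W W'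
    using hlift_vector_field[OF W] u
    by (intro nabla_vanishing_field[OF u _ nabla_pi_field[OF hlift_vector_field[OF W'] eta_pi_field] Kh[OF W']])
       (auto simp: vector_fields_def)
  then show ?thesis
    using X Y unfolding R_hat_def h_curvature_def curvature_def by simp
qed

text \<open>This is the vanishing of the square of the horizontal differential on a pair with
  horizontal bracket. It is phrased for any \<open>\<theta>\<close> agreeing with the differential
  of \<open>f\<close> over the slit bundle, because the metric dual of a gradient is controlled only
  there.\<close>

lemma dbar_form_dbar_fun:
  assumes X: "X \<in> pi_fields A" and Y: "Y \<in> pi_fields A" and u: "u \<in> slit_bundle A"
    and f: "f \<in> smooth_funs (slit_atlas A)"
    and \<theta>: "\<And>v w. v \<in> slit_bundle A \<Longrightarrow> w \<in> tangent_space A (fst v) \<Longrightarrow> \<theta> v w = beta A nabla v w f"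
    and flat: "R_hat A nabla X Y u = 0"
  shows "dbar_form A nabla \<theta> X Y u = 0"
proof -
  let ?X = "hlift A nabla X" and ?Y = "hlift A nabla Y"
  let ?B = "lie_bracket (slit_atlas A) ?X ?Y u"
  note hX = hlift_vector_field[OF X] and hY = hlift_vector_field[OF Y]
  have B: "?B \<in> tangent_space (slit_atlas A) u"
    by (rule TM.lie_bracket_tangent[unfolded slit_cover, OF hX hY u])
  have "?B \<in> hor A nabla u"
    using B flat R_hat_eq_K_bracket[OF X Y u] by (simp add: hor_iff)
  then have "\<theta> u (rho A ?B) = ?B f"
    using \<theta>[OF u rho_tangent[OF B]] beta_rho[OF u] by simp
  also have "\<dots> = ?X u (\<lambda>v. ?Y v f) - ?Y u (\<lambda>v. ?X v f)"
    using f by (simp add: lie_bracket_def)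
  finally have 1: "\<theta> u (rho A ?B) = ?X u (\<lambda>v. ?Y v f) - ?Y u (\<lambda>v. ?X v f)" .
  have 2: "hlift A nabla W u (\<lambda>v. hlift A nabla W' v f) = hlift A nabla W u (\<lambda>v. \<theta> v (W' v))"
    if W: "W \<in> pi_fields A" and W': "W' \<in> pi_fields A" for W W'
  proof -
    have D: "hlift A nabla W u \<in> tangent_space (slit_atlas A) u"
      using hlift_vector_field[OF W] u by (simp add: vector_fields_def)
    have sm: "(\<lambda>v. hlift A nabla W' v f) \<in> smooth_funs (slit_atlas A)"
      using hlift_vector_field[OF W'] f by (simp add: vector_fields_def)
    have "hlift A nabla W' v f = \<theta> v (W' v)" if "v \<in> slit_bundle A" for v
      using \<theta>[OF that pi_field_tangent[OF W' that]] by (simp add: hlift_def)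
    then show ?thesis by (rule TM.tangent_cong[unfolded slit_cover, OF D u sm])
  qed
  show ?thesis
    unfolding dbar_form_def 1 2[OF X Y, symmetric] 2[OF Y X, symmetric] by simp
qed

text \<open>As \<open>\<kappa>\<close> is 0 only on the slit bundle, the line
  \<open>snd u + t *\<^sub>v w\<close> must avoid the zero vector for small \<open>t\<close>.
  Evaluation at one function \<open>h\<close> with \<open>snd u h \<noteq> 0\<close> reduces this to
  continuity of a real function, without a topology on the tangent space.\<close>

lemma dJ_vanishing_fun:
  assumes u: "u \<in> slit_bundle A" and w: "w \<in> tangent_space A (fst u)"
    and \<kappa>: "\<And>v. v \<in> slit_bundle A \<Longrightarrow> \<kappa> v = 0"
  shows "dJ A \<kappa> u w = 0"
proof -
  obtain h where h: "snd u h \<noteq> 0"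
    using u by (auto simp: slit_bundle_def fun_eq_iff)
  have "((\<lambda>t. snd u h + t * w h) \<longlongrightarrow> snd u h + 0 * w h) (nhds 0)"
    by (intro tendsto_intros filterlim_ident)
  then have "\<forall>\<^sub>F t in nhds 0. snd u h + t * w h \<in> - {0}"
    by (rule topological_tendstoD) (use h in auto)
  then have "\<forall>\<^sub>F t in nhds 0. \<kappa> (fst u, snd u + t *\<^sub>v w) = 0"
  proof (rule eventually_mono)
    fix t assume "snd u h + t * w h \<in> - {0}"
    then have "snd u + t *\<^sub>v w \<noteq> 0" by (auto simp: fun_eq_iff)
    moreover have "snd u + t *\<^sub>v w \<in> tangent_space A (fst u)"
      using u w by (intro add_tangent scale_tangent) (auto simp: slit_bundle_def)
    ultimately show "\<kappa> (fst u, snd u + t *\<^sub>v w) = 0"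
      by (intro \<kappa>) (simp add: slit_bundle_def)
  qed
  from deriv_cong_ev[OF this refl] show ?thesis
    by (simp add: dJ_def gam_def)
qed

text \<open>\<open>omega\<close> contains the fibre derivative of \<open>\<kappa>\<close> besides
  its value; as both are 0, so are both terms of the prescribed curvature.\<close>

lemma R_hat_eq_0:
  assumes sc: "scalar_curvature A L nabla \<kappa>" and \<kappa>: "\<And>v. v \<in> slit_bundle A \<Longrightarrow> \<kappa> v = 0"
    and X: "X \<in> pi_fields A" and Y: "Y \<in> pi_fields A" and u: "u \<in> slit_bundle A"
  shows "R_hat A nabla X Y u = 0"
proof -
  have "omega A L \<kappa> u (W u) = 0" if "W \<in> pi_fields A" for W
    using dJ_vanishing_fun[OF u pi_field_tangent[OF that u] \<kappa>] \<kappa>[OF u] by (simp add: omega_def)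
  then show ?thesis
    using sc X Y u unfolding scalar_curvature_def by (simp add: fun_eq_iff)
qed

end

theorem proposition2p10:
  fixes A :: "('a::{t2_space, second_countable_topology}, 'e::euclidean_space) chart set"
    and L \<kappa> f :: "'a tb \<Rightarrow> real"
    and nabla :: "'a pi_connection"
  assumes "smooth_atlas A"
    and "finsler_structure A L"
    and "cartan_connection A L nabla"
    and "scalar_curvature A L nabla \<kappa>"
    and "\<forall>u\<in>slit_bundle A. \<kappa> u = 0"
    and "f \<in> smooth_funs (slit_atlas A)"
  shows "dbar_closed A L nabla (grad A L nabla f)"
proof -
  interpret regular_pi_connection A nabla
    using assms(1,3) by unfold_locales (simp_all add: cartan_connection_def)
  have "R_hat A nabla X Y u = 0" if "X \<in> pi_fields A" "Y \<in> pi_fields A" "u \<in> slit_bundle A" for X Y u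
    by (rule R_hat_eq_0[OF assms(4) _ that]) (use assms(5) in blast)
  then show ?thesis
    unfolding dbar_closed_def
    by (intro ballI dbar_form_dbar_fun[OF _ _ _ assms(6) metric_dual_grad[OF assms(2)]])
qed

end
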